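(* Let $\varphi\in\mathcal S_{\mathbb P_{\mathbb N}}(\mathrm{CAR}(\mathbb N))$ be a symmetric state. Then the following are equivalent. (i) $\varphi$ is an extreme point of $\mathcal S_{\mathbb P_{\mathbb N}}(\mathrm{CAR}(\mathbb N))$. (ii) $\varphi$ is strongly clustering. (iii) $\varphi=\prod_{\mathbb N}\rho$ for some even state $\rho$ on $\mathbb M_2(\mathbb C)$.
   Context: $\mathrm{CAR}(\mathbb N)$ is the unital $C^*$-algebra generated by $\{a_j,a_j^\dagger : j\in\mathbb N\}$, $\mathbb N=\{1,2,\dots\}$, with $(a_j)^*=a_j^\dagger$, $\{a_j^\dagger,a_k\}=\delta_{jk}1$, $\{a_j,a_k\}=\{a_j^\dagger,a_k^\dagger\}=0$, where $\{a,b\}=ab+ba$. $\mathbb P_{\mathbb N}$ is the group of permutations of $\mathbb N$ moving only finitely many elements, acting on $\mathrm{CAR}(\mathbb N)$ by the automorphisms $\alpha_g$ with $\alpha_g(a_j)=a_{gj}$. A state is symmetric if it is invariant under all $\alpha_g$; $\mathcal S_{\mathbb P_{\mathbb N}}(\mathrm{CAR}(\mathbb N))$ is the convex, $*$-weakly compact set of symmetric states. For $n\in\mathbb N$ let $g_n\in\mathbb P_{\mathbb N}$ be $$g_n(k)=\begin{cases}2^{n-1}+k & 1\le k\le 2^{n-1},\\ k-2^{n-1} & 2^{n-1}<k\le 2^n,\\ k & 2^n<k.\end{cases}$$ A state $\varphi$ on $\mathrm{CAR}(\mathbb N)$ is strongly clustering if $\lim_n\varphi(\alpha_{g_n}(A)B)=\varphi(A)\varphi(B)$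 for all $A,B\in\mathrm{CAR}(\mathbb N)$. For each $j$, $\iota_j:\mathbb M_2(\mathbb C)\to\mathrm{CAR}(\mathbb N)$ is the embedding with range $\mathrm{CAR}(\{j\})$ sending the matrix units $e_{11},e_{12},e_{21},e_{22}$ to $a_ja_j^\dagger,a_j,a_j^\dagger,a_j^\dagger a_j$. A state on $\mathbb M_2(\mathbb C)$ is even if it is invariant under the grading inherited from $\mathrm{CAR}(\{j\})$ (the automorphism induced by $a_j\mapsto -a_j$), i.e. it vanishes on $e_{12},e_{21}$. For an even state $\rho$ on $\mathbb M_2(\mathbb C)$, the (Araki–Moriya) product state $\prod_{\mathbb N}\rho$ is the unique state $\varphi$ on $\mathrm{CAR}(\mathbb N)$ with $$\varphi(\iota_{j_1}(A_1)\cdots\iota_{j_n}(A_n))=\prod_{k=1}^n\rho(A_k)$$ for all distinct $j_1,\dots,j_n\in\mathbb N$ and $A_1,\dots,A_n\in\mathbb M_2(\mathbb C)$. *)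

theory Defs
  imports "HOL-Analysis.Analysis" "HOL-Combinatorics.Permutations"
begin

section \<open>Unital C*-algebras\<close>

text \<open>
  Nonzero unital complex C*-algebras: complete by \<^class>\<open>banach\<close>, with submultiplicative norm and
  \<open>norm 1 = 1\<close> by \<^class>\<open>real_normed_algebra_1\<close>. The complex structure extends the real one.
\<close>

class cstar_algebra = banach + real_normed_algebra_1 +
  fixes scaleC :: "complex \<Rightarrow> 'a \<Rightarrow> 'a"  (infixr \<open>*\<^sub>C\<close> 75)
    and star :: "'a \<Rightarrow> 'a"
  assumes scaleR_scaleC: "scaleR r x = complex_of_real r *\<^sub>C x"
    and scaleC_add_right: "c *\<^sub>C (x + y) = c *\<^sub>C x + c *\<^sub>C y"
    and scaleC_add_left: "(c + d) *\<^sub>C x = c *\<^sub>C x + d *\<^sub>C x"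
    and scaleC_scaleC: "c *\<^sub>C d *\<^sub>C x = (c * d) *\<^sub>C x"
    and mult_scaleC_left: "(c *\<^sub>C x) * y = c *\<^sub>C (x * y)"
    and mult_scaleC_right: "x * (c *\<^sub>C y) = c *\<^sub>C (x * y)"
    and norm_scaleC: "norm (c *\<^sub>C x) = cmod c * norm x"
    and star_star: "star (star x) = x"
    and star_add: "star (x + y) = star x + star y"
    and star_scaleC: "star (c *\<^sub>C x) = cnj c *\<^sub>C star x"
    and star_mult: "star (x * y) = star y * star x"
    and norm_star_mult_self: "norm (star x * x) = (norm x)\<^sup>2"

definition star_subalgebra :: "'a::cstar_algebra set \<Rightarrow> bool" where
  "star_subalgebra S \<longleftrightarrow> 1 \<in> S \<and>
     (\<forall>x\<in>S. \<forall>y\<in>S. x + y \<in> S \<and> x * y \<in> S) \<and>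
     (\<forall>c. \<forall>x\<in>S. c *\<^sub>C x \<in> S) \<and> (\<forall>x\<in>S. star x \<in> S)"

text \<open>
  Isometry is automatic for *-automorphisms of C*-algebras; it is listed as part of the structure
  being preserved.
\<close>

definition cstar_automorphism :: "('a::cstar_algebra \<Rightarrow> 'a) \<Rightarrow> bool" where
  "cstar_automorphism \<alpha> \<longleftrightarrow> bij \<alpha> \<and> \<alpha> 1 = 1 \<and>
     (\<forall>x y. \<alpha> (x + y) = \<alpha> x + \<alpha> y) \<and> (\<forall>x y. \<alpha> (x * y) = \<alpha> x * \<alpha> y) \<and>
     (\<forall>c x. \<alpha> (c *\<^sub>C x) = c *\<^sub>C \<alpha> x) \<and> (\<forall>x. \<alpha> (star x) = star (\<alpha> x)) \<and>
     (\<forall>x. norm (\<alpha> x) = norm x)"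

text \<open>
  States are taken in the space of bounded real-linear maps to \<open>\<complex>\<close>, so that convexity and
  \<^const>\<open>extreme_point_of\<close> are the library notions. This is no restriction, because positive
  linear functionals on a unital C*-algebra are bounded.
\<close>

definition state :: "('a::cstar_algebra \<Rightarrow>\<^sub>L complex) \<Rightarrow> bool" where
  "state \<phi> \<longleftrightarrow> (\<forall>c x. blinfun_apply \<phi> (c *\<^sub>C x) = c * blinfun_apply \<phi> x) \<and>
     (\<forall>x. blinfun_apply \<phi> (star x * x) \<in> \<real>\<^sub>\<ge>\<^sub>0) \<and> blinfun_apply \<phi> 1 = 1"


section \<open>The CAR algebra\<close>

text \<open>
  \<open>car_algebra a\<close> says that the whole type \<open>'a\<close> is the C*-algebra generated by annihilators \<open>a j\<close>
  obeying the canonical anticommutation relations; this determines it up to isomorphism.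
  The index set is \<open>{1, 2, \<dots>}\<close>, so the value \<open>a 0\<close> is irrelevant throughout. The relations
  between the creators follow by taking adjoints.
\<close>

definition anticommutator :: "'a::ring \<Rightarrow> 'a \<Rightarrow> 'a" where
  "anticommutator x y = x * y + y * x"

definition car_algebra :: "(nat \<Rightarrow> 'a::cstar_algebra) \<Rightarrow> bool" where
  "car_algebra a \<longleftrightarrow>
     (\<forall>j\<ge>1. \<forall>k\<ge>1. anticommutator (star (a j)) (a k) = (if j = k then 1 else 0) \<and>
        anticommutator (a j) (a k) = 0 \<and> anticommutator (star (a j)) (star (a k)) = 0) \<and>
     (\<forall>S. closed S \<and> star_subalgebra S \<and> (\<forall>j\<ge>1. a j \<in> S) \<longrightarrow> S = UNIV)"

definition fin_perms :: "(nat \<Rightarrow> nat) set" where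
  "fin_perms = {g. g permutes {1..} \<and> finite {k. g k \<noteq> k}}"

definition car_action :: "(nat \<Rightarrow> 'a::cstar_algebra) \<Rightarrow> (nat \<Rightarrow> nat) \<Rightarrow> 'a \<Rightarrow> 'a" where
  "car_action a g = (THE \<alpha>. cstar_automorphism \<alpha> \<and> (\<forall>j\<ge>1. \<alpha> (a j) = a (g j)))"

definition symmetric_states :: "(nat \<Rightarrow> 'a::cstar_algebra) \<Rightarrow> ('a \<Rightarrow>\<^sub>L complex) set" where
  "symmetric_states a = {\<phi>. state \<phi> \<and>
     (\<forall>g\<in>fin_perms. \<forall>x. blinfun_apply \<phi> (car_action a g x) = blinfun_apply \<phi> x)}"

text \<open>Meaningful for \<open>n \<ge> 1\<close>; below only the limit \<open>n \<rightarrow> \<infinity>\<close> matters.\<close>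

definition block_swap :: "nat \<Rightarrow> nat \<Rightarrow> nat" where
  "block_swap n k =
     (if 1 \<le> k \<and> k \<le> 2 ^ (n - 1) then 2 ^ (n - 1) + k
      else if 2 ^ (n - 1) < k \<and> k \<le> 2 ^ n then k - 2 ^ (n - 1)
      else k)"

definition strongly_clustering ::
    "(nat \<Rightarrow> 'a::cstar_algebra) \<Rightarrow> ('a \<Rightarrow>\<^sub>L complex) \<Rightarrow> bool" where
  "strongly_clustering a \<phi> \<longleftrightarrow>
     (\<forall>x y. (\<lambda>n. blinfun_apply \<phi> (car_action a (block_swap n) x * y))
        \<longlonglongrightarrow> blinfun_apply \<phi> x * blinfun_apply \<phi> y)"


section \<open>Product states\<close>

definition adjoint_mat :: "complex^2^2 \<Rightarrow> complex^2^2" where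
  "adjoint_mat A = (\<chi> i j. cnj (A $ j $ i))"

definition mat2_state :: "(complex^2^2 \<Rightarrow> complex) \<Rightarrow> bool" where
  "mat2_state \<rho> \<longleftrightarrow> (\<forall>A B. \<rho> (A + B) = \<rho> A + \<rho> B) \<and>
     (\<forall>c A. \<rho> (\<chi> i j. c * A $ i $ j) = c * \<rho> A) \<and>
     (\<forall>A. \<rho> (adjoint_mat A ** A) \<in> \<real>\<^sub>\<ge>\<^sub>0) \<and> \<rho> (mat 1) = 1"

text \<open>
  Under the embedding \<open>car_embed a j\<close> below, \<open>a j \<mapsto> - a j\<close> fixes the diagonal matrix units
  and changes the sign of the off-diagonal ones.
\<close>

definition mat2_grading :: "complex^2^2 \<Rightarrow> complex^2^2" where
  "mat2_grading A = (\<chi> i j. if i = j then A $ i $ j else - (A $ i $ j))"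

definition mat2_even :: "(complex^2^2 \<Rightarrow> complex) \<Rightarrow> bool" where
  "mat2_even \<rho> \<longleftrightarrow> (\<forall>A. \<rho> (mat2_grading A) = \<rho> A)"

definition car_embed :: "(nat \<Rightarrow> 'a::cstar_algebra) \<Rightarrow> nat \<Rightarrow> complex^2^2 \<Rightarrow> 'a" where
  "car_embed a j A =
     A $ 1 $ 1 *\<^sub>C (a j * star (a j)) + A $ 1 $ 2 *\<^sub>C a j +
     A $ 2 $ 1 *\<^sub>C star (a j) + A $ 2 $ 2 *\<^sub>C (star (a j) * a j)"

text \<open>
  \<open>is_product_state a \<rho> \<phi>\<close> expresses that \<open>\<phi>\<close> is the product state of \<open>\<rho>\<close>. For given \<open>\<rho>\<close> at most
  one \<open>\<phi>\<close> qualifies, since the products of embedded matrices span a dense subspace.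
\<close>

definition is_product_state ::
    "(nat \<Rightarrow> 'a::cstar_algebra) \<Rightarrow> (complex^2^2 \<Rightarrow> complex) \<Rightarrow> ('a \<Rightarrow>\<^sub>L complex) \<Rightarrow> bool" where
  "is_product_state a \<rho> \<phi> \<longleftrightarrow> state \<phi> \<and>
     (\<forall>js As. distinct js \<and> set js \<subseteq> {1..} \<and> length As = length js \<longrightarrow>
        blinfun_apply \<phi> (prod_list (map2 (car_embed a) js As)) = prod_list (map \<rho> As))"

end

theory Submission
  imports Defs
begin

text \<open>
  Averaging \<open>a j\<close> over many fresh sites gives elements of norm at most \<open>1 / sqrt N\<close>, so a symmetric
  state kills every product with an odd factor and is determined by its values on products of the
  number operators \<open>n j = star (a j) * a j\<close> and their complements. It is a product state iff
  \<open>\<phi> (n j * x) = p * \<phi> x\<close> for all products \<open>x\<close> over other sites. Strong clustering gives this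
  by moving site \<open>j\<close> to infinity, and conversely product states cluster on the dense span of products.
  For extreme \<open>\<phi>\<close>, the functional \<open>\<psi> x = lim \<phi> (n k * x)\<close> is symmetric with \<open>0 \<le> \<psi> \<le> \<phi>\<close>, hence a
  multiple of \<open>\<phi>\<close>. A product state is extreme because every symmetric state dominated by a multiple
  of it inherits the law of large numbers for the number operators, and so the same \<open>p\<close>.
\<close>

section \<open>Elementary consequences of the C*-axioms\<close>

context cstar_algebra
begin

lemma star_one [simp]: "star 1 = 1"
  by (metis mult_1_left mult_1_right star_mult star_star)

lemma star_zero [simp]: "star 0 = 0"
  using star_add[of 0 0] by simp

lemma star_minus [simp]: "star (- x) = - star x"
  using star_add[of "- x" x] by (simp add: eq_neg_iff_add_eq_0)

lemma star_diff: "star (x - y) = star x - star y"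
  using star_add[of x "- y"] by simp

lemma scaleC_zero_right [simp]: "c *\<^sub>C 0 = 0"
  using scaleC_add_right[of c 0 0] by simp

lemma scaleC_zero_left [simp]: "0 *\<^sub>C x = 0"
  using scaleC_add_left[of 0 0 x] by simp

lemma scaleC_one [simp]: "1 *\<^sub>C x = x"
  by (metis of_real_1 scaleR_one scaleR_scaleC)

lemma scaleC_minus_left [simp]: "(- c) *\<^sub>C x = - (c *\<^sub>C x)"
  using scaleC_add_left[of "- c" c x] by (simp add: eq_neg_iff_add_eq_0)

lemma scaleC_minus_right [simp]: "c *\<^sub>C (- x) = - (c *\<^sub>C x)"
  using scaleC_add_right[of c "- x" x] by (simp add: eq_neg_iff_add_eq_0)

lemma scaleC_diff_right: "c *\<^sub>C (x - y) = c *\<^sub>C x - c *\<^sub>C y"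
  using scaleC_add_right[of c x "- y"] by simp

lemma star_sum: "star (sum f F) = (\<Sum>i\<in>F. star (f i))"
  by (induction F rule: infinite_finite_induct) (auto simp: star_add)

end

text \<open>The C*-identity and submultiplicativity bound the square of \<open>norm y\<close> by
  \<open>norm (star y) * norm y\<close>; cancelling gives one inequality, and applying it to
  \<open>star x\<close> gives the other.\<close>

lemma norm_star [simp]: "norm (star x) = norm x"
  for x :: "'a::cstar_algebra"
proof -
  have le: "norm y \<le> norm (star y)" for y :: 'a
  proof (cases "norm y = 0")
    case False
    have "norm y * norm y \<le> norm (star y) * norm y"
      using norm_mult_ineq[of "star y" y] unfolding norm_star_mult_self power2_eq_square .
    then show ?thesis using False by (metis mult_right_le_imp_le norm_ge_zero order_less_le)
  qed simp
  from le[of x] le[of "star x"] show ?thesis by (simp add: star_star)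
qed

lemma bounded_linear_star: "bounded_linear (star :: 'a::cstar_algebra \<Rightarrow> 'a)"
  by (rule bounded_linear_intro[where K = 1]) (auto simp: star_add star_scaleC scaleR_scaleC)

lemma bounded_linear_scaleC: "bounded_linear (\<lambda>x::'a::cstar_algebra. c *\<^sub>C x)"
  by (rule bounded_linear_intro[where K = "cmod c"])
    (auto simp: scaleC_add_right scaleR_scaleC scaleC_scaleC norm_scaleC mult.commute)

lemmas continuous_on_star [continuous_intros] = bounded_linear.continuous_on[OF bounded_linear_star]
lemmas continuous_on_scaleC [continuous_intros] = bounded_linear.continuous_on[OF bounded_linear_scaleC]

section \<open>Limits of uniformly bounded families of maps\<close>

text \<open>The bound turns approximation of \<open>x\<close> into approximation of
  \<open>T k x\<close> uniformly in \<open>k\<close>. Combined with density, this extends a limit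
  checked on words to the whole algebra.\<close>

lemma tendsto_zero_closed:
  fixes T :: "nat \<Rightarrow> 'a::real_normed_vector \<Rightarrow> 'b::real_normed_vector"
  assumes diff: "\<And>k x y. T k (x - y) = T k x - T k y" and bound: "\<And>k x. norm (T k x) \<le> C * norm x"
  shows "closed {x. (\<lambda>k. T k x) \<longlonglongrightarrow> 0}"
proof -
  have "x \<in> {x. (\<lambda>k. T k x) \<longlonglongrightarrow> 0}" if "x \<in> closure {x. (\<lambda>k. T k x) \<longlonglongrightarrow> 0}" for x
  proof -
    have "(\<lambda>k. T k x) \<longlonglongrightarrow> 0"
    proof (rule LIMSEQ_I)
      fix e :: real assume e: "e > 0"
      define C' where "C' = \<bar>C\<bar> + 1"
      have C': "C' > 0" by (simp add: C'_def)
      have "e / (2 * C') > 0" using e C' by simp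
      with that obtain y where y: "(\<lambda>k. T k y) \<longlonglongrightarrow> 0" "dist y x < e / (2 * C')"
        unfolding closure_approachable by blast
      from y(1) e obtain N where N: "\<And>k. k \<ge> N \<Longrightarrow> norm (T k y) < e / 2"
        by (metis LIMSEQ_D diff_zero half_gt_zero)
      have "norm (T k x) < e" if "k \<ge> N" for k
      proof -
        have "norm (T k (x - y)) \<le> C' * norm (x - y)"
          using bound[of k "x - y"] by (smt (verit) C'_def mult_right_mono norm_ge_zero)
        also have "\<dots> < C' * (e / (2 * C'))"
          using y(2) C' by (intro mult_strict_left_mono) (auto simp: dist_norm norm_minus_commute)
        also have "\<dots> = e / 2" using C' by simp
        finally have "norm (T k x - T k y) < e / 2" by (simp add: diff)
        with N[OF that] norm_triangle_ineq2[of "T k x" "T k y"] show ?thesis by linarith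
      qed
      then show "\<exists>N. \<forall>k\<ge>N. norm (T k x - 0) < e" by auto
    qed
    then show ?thesis by simp
  qed
  then show ?thesis by (metis closure_subset closed_closure subsetI subset_antisym)
qed

text \<open>The variant for limits whose value is not known beforehand; completeness of the scalars
  turns these Cauchy sequences into the limit functional of \<open>extreme_factors\<close>.\<close>

lemma Cauchy_closed:
  fixes T :: "nat \<Rightarrow> 'a::real_normed_vector \<Rightarrow> 'b::real_normed_vector"
  assumes diff: "\<And>k x y. T k (x - y) = T k x - T k y" and bound: "\<And>k x. norm (T k x) \<le> C * norm x"
  shows "closed {x. Cauchy (\<lambda>k. T k x)}"
proof -
  have "Cauchy (\<lambda>k. T k x)" if x: "x \<in> closure {x. Cauchy (\<lambda>k. T k x)}" for x
  proof (rule CauchyI)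
    fix e :: real assume e: "e > 0"
    define C' where "C' = \<bar>C\<bar> + 1"
    have C': "C' > 0" by (simp add: C'_def)
    have "e / (3 * C') > 0" using e C' by simp
    with x obtain y where y: "Cauchy (\<lambda>k. T k y)" "dist y x < e / (3 * C')"
      unfolding closure_approachable by blast
    from y(1) e obtain N where N: "\<And>m k. m \<ge> N \<Longrightarrow> k \<ge> N \<Longrightarrow> norm (T m y - T k y) < e / 3"
      using CauchyD[OF y(1), of "e / 3"] by auto
    have near: "norm (T k x - T k y) < e / 3" for k
    proof -
      have "norm (T k (x - y)) \<le> C' * norm (x - y)"
        using bound[of k "x - y"] by (smt (verit) C'_def mult_right_mono norm_ge_zero)
      also have "\<dots> < C' * (e / (3 * C'))"
        using y(2) C' by (intro mult_strict_left_mono) (auto simp: dist_norm norm_minus_commute)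
      also have "\<dots> = e / 3" using C' by simp
      finally show ?thesis by (simp add: diff)
    qed
    have "norm (T m x - T k x) < e" if "m \<ge> N" "k \<ge> N" for m k
    proof -
      have "T m x - T k x = (T m x - T m y) + (T m y - T k y) - (T k x - T k y)" by simp
      also have "norm \<dots> \<le> norm (T m x - T m y) + norm (T m y - T k y) + norm (T k x - T k y)"
        by (meson add_right_mono norm_triangle_ineq norm_triangle_ineq4 order_trans)
      also have "\<dots> < e" using near[of m] near[of k] N[OF that] by linarith
      finally show ?thesis .
    qed
    then show "\<exists>N. \<forall>m\<ge>N. \<forall>k\<ge>N. norm (T m x - T k x) < e" by blast
  qed
  then show ?thesis by (metis (mono_tags, lifting) closure_subset closed_closure mem_Collect_eq subsetI subset_antisym)
qed

lemma nat_mult_bounded_imp_nonpos: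
  assumes "\<And>N::nat. real N * c \<le> K"
  shows "c \<le> 0"
proof (rule ccontr)
  assume "\<not> c \<le> 0"
  then obtain N :: nat where "K < real N * c" using ex_less_of_nat_mult[of c K] by auto
  with assms[of N] show False by simp
qed

section \<open>States\<close>

context
  fixes \<phi> :: "'a::cstar_algebra \<Rightarrow>\<^sub>L complex"
  assumes st: "state \<phi>"
begin

lemma state_scaleC: "\<phi> (c *\<^sub>C x) = c * \<phi> x"
  using st by (simp add: state_def)

lemma state_one: "\<phi> 1 = 1"
  using st by (simp add: state_def)

lemma state_nonneg: "\<phi> (star x * x) = of_real (Re (\<phi> (star x * x)))" "0 \<le> Re (\<phi> (star x * x))"
proof -
  have "\<phi> (star x * x) \<in> \<real>\<^sub>\<ge>\<^sub>0" using st by (simp add: state_def)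
  then show "\<phi> (star x * x) = of_real (Re (\<phi> (star x * x)))" "0 \<le> Re (\<phi> (star x * x))"
    by (auto simp: complex_nonneg_Reals_iff complex_eq_iff)
qed

lemma state_form: "\<phi> (star (x + c *\<^sub>C y) * (x + c *\<^sub>C y)) =
    \<phi> (star x * x) + c * \<phi> (star x * y) + cnj c * \<phi> (star y * x) + (cnj c * c) * \<phi> (star y * y)"
  by (simp add: star_add star_scaleC algebra_simps mult_scaleC_left mult_scaleC_right
      scaleC_scaleC blinfun.add_right state_scaleC)

lemma state_hermitian: "\<phi> (star y * x) = cnj (\<phi> (star x * y))"
proof -
  have im: "Im (\<phi> (star z * z)) = 0" for z using state_nonneg(1)[of z] by (metis Im_complex_of_real)
  have "Im (c * \<phi> (star x * y) + cnj c * \<phi> (star y * x)) = 0" for c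
    using im[of "x + c *\<^sub>C y"] im[of x] im[of y] unfolding state_form by (simp add: algebra_simps)
  \<comment> \<open>\<open>c = 1\<close> makes the imaginary parts opposite, \<open>c = \<i>\<close>
    makes the real parts equal.\<close>
  from this[of 1] this[of \<i>] show ?thesis by (simp add: complex_eq_iff)
qed

lemma state_Cauchy_Schwarz:
  "(cmod (\<phi> (star x * y)))\<^sup>2 \<le> Re (\<phi> (star x * x)) * Re (\<phi> (star y * y))"
proof -
  define z where "z = \<phi> (star x * y)"
  define P where "P = Re (\<phi> (star x * x))"
  define Q where "Q = Re (\<phi> (star y * y))"
  have P: "\<phi> (star x * x) = of_real P" "P \<ge> 0" and Q: "\<phi> (star y * y) = of_real Q" "Q \<ge> 0"
    using state_nonneg[of x] state_nonneg[of y] by (auto simp: P_def Q_def)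
  have zz: "\<phi> (star y * x) = cnj z" using state_hermitian[of y x] by (simp add: z_def)
  \<comment> \<open>The coefficient of \<open>y\<close> carries the factor \<open>cnj z\<close>,
    which makes both cross terms real, so that positivity becomes a real quadratic inequality in
    \<open>t\<close>.\<close>
  have key: "P - 2 * t * (cmod z)\<^sup>2 + t\<^sup>2 * (cmod z)\<^sup>2 * Q \<ge> 0" for t :: real
  proof -
    have "\<phi> (star (x + (- of_real t * cnj z) *\<^sub>C y) * (x + (- of_real t * cnj z) *\<^sub>C y)) =
        of_real P - of_real (2 * t) * (z * cnj z) + of_real (t\<^sup>2) * (z * cnj z) * of_real Q"
      unfolding state_form P Q zz z_def[symmetric] by (simp add: algebra_simps power2_eq_square)
    also have "\<dots> = of_real (P - 2 * t * (cmod z)\<^sup>2 + t\<^sup>2 * (cmod z)\<^sup>2 * Q)"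
      using complex_norm_square[of z] by simp
    finally show ?thesis
      by (metis Re_complex_of_real state_nonneg(2))
  qed
  have "(cmod z)\<^sup>2 \<le> P * Q"
  proof (cases "Q = 0")
    case True
    \<comment> \<open>A vanishing \<open>Q\<close> leaves an inequality affine in \<open>t\<close>;
      letting \<open>t\<close> grow forces \<open>z\<close> to vanish.\<close>
    have "real N * (cmod z)\<^sup>2 \<le> P" for N
      using key[of "real N / 2"] True by simp
    then show ?thesis using nat_mult_bounded_imp_nonpos[of "(cmod z)\<^sup>2" P] True by simp
  next
    case False
    then have "Q > 0" using Q by simp
    moreover have "P - (cmod z)\<^sup>2 / Q \<ge> 0"
      using key[of "1 / Q"] \<open>Q > 0\<close> by (simp add: power2_eq_square field_simps)
    ultimately show ?thesis by (simp add: field_simps)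
  qed
  then show ?thesis by (simp add: z_def P_def Q_def)
qed

end

section \<open>Automorphisms\<close>

context
  fixes \<alpha> :: "'a::cstar_algebra \<Rightarrow> 'a"
  assumes aut: "cstar_automorphism \<alpha>"
begin

lemma aut_add: "\<alpha> (x + y) = \<alpha> x + \<alpha> y"
  and aut_mult: "\<alpha> (x * y) = \<alpha> x * \<alpha> y"
  and aut_scaleC: "\<alpha> (c *\<^sub>C x) = c *\<^sub>C \<alpha> x"
  and aut_star: "\<alpha> (star x) = star (\<alpha> x)"
  and aut_one: "\<alpha> 1 = 1"
  and aut_norm: "norm (\<alpha> x) = norm x"
  using aut by (auto simp: cstar_automorphism_def)

lemma aut_diff: "\<alpha> (x - y) = \<alpha> x - \<alpha> y"
  using aut_add[of "x - y" y] by (simp add: algebra_simps)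

lemma aut_continuous: "continuous_on S \<alpha>"
  by (intro linear_continuous_on bounded_linear_intro[where K = 1])
    (auto simp: aut_add aut_norm scaleR_scaleC aut_scaleC)

end

lemma aut_compose:
  "cstar_automorphism \<alpha> \<Longrightarrow> cstar_automorphism \<beta> \<Longrightarrow> cstar_automorphism (\<alpha> \<circ> \<beta>)"
  by (auto simp: cstar_automorphism_def bij_comp)

lemma aut_id: "cstar_automorphism id"
  by (auto simp: cstar_automorphism_def)

text \<open>Conjugation by such a symmetry is its own inverse. Since \<open>norm u = 1\<close> it is
  contractive, and applying the contraction twice makes it isometric.\<close>

lemma aut_conjugation:
  fixes u :: "'a::cstar_algebra"
  assumes u: "star u = u" "u * u = 1"
  shows "cstar_automorphism (\<lambda>x. u * x * u)"
proof -
  have uu: "u * (u * x) = x" for x by (simp add: u flip: mult.assoc)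
  have inv: "u * (u * x * u) * u = x" for x
    by (simp add: u uu mult.assoc)
  have "norm u = 1"
    using norm_star_mult_self[of u] by (simp add: u power2_eq_1_iff) (smt (verit) norm_ge_zero)
  then have le: "norm (u * x * u) \<le> norm x" for x
    by (metis mult_cancel_left1 mult_cancel_right1 norm_mult_ineq order_trans)
  have "norm (u * x * u) = norm x" for x
    using le[of x] le[of "u * x * u"] by (simp add: inv)
  moreover have "bij (\<lambda>x. u * x * u)"
    by (rule o_bij[where g = "\<lambda>x. u * x * u"]) (auto simp: fun_eq_iff inv)
  ultimately show ?thesis
    by (simp add: cstar_automorphism_def algebra_simps star_mult mult_scaleC_left mult_scaleC_right u uu)
qed

lemma anticommute_mult:
  fixes x :: "'a::ring"
  assumes "x * b = - (b * x)" "x * c = - (c * x)"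
  shows "x * (b * c) = b * c * x"
proof -
  have "x * (b * c) = (x * b) * c" by (simp add: mult.assoc)
  also have "\<dots> = - (b * (x * c))" by (simp add: assms(1) mult.assoc)
  also have "\<dots> = b * c * x" by (simp add: assms(2) mult.assoc)
  finally show ?thesis .
qed

section \<open>Finite permutations and block swaps\<close>

lemma fin_perms_ge1: "g \<in> fin_perms \<Longrightarrow> j \<ge> 1 \<Longrightarrow> g j \<ge> 1"
  using permutes_in_image[of g "{1..}" j] by (simp add: fin_perms_def)

lemma transpose_fin_perms: "i \<ge> 1 \<Longrightarrow> j \<ge> 1 \<Longrightarrow> Transposition.transpose i j \<in> fin_perms"
  by (auto simp: fin_perms_def permutes_swap_id Transposition.transpose_def intro: finite_subset[of _ "{i, j}"])

text \<open>For positive \<open>n\<close> the two blocks have equal length and the map is an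
  involution. At \<open>n = 0\<close> truncated subtraction sends both 1 and 2 to 2, which is why
  later limits use \<open>block_swap (Suc n)\<close>.\<close>

lemma block_swap_fin_perms:
  assumes "n \<ge> 1" shows "block_swap n \<in> fin_perms"
proof -
  have two: "(2::nat) ^ n = 2 ^ (n - 1) + 2 ^ (n - 1)"
    using assms by (cases n) auto
  have inv: "block_swap n (block_swap n k) = k" for k
    by (auto simp: block_swap_def two)
  have "bij_betw (block_swap n) {1..} {1..}"
    by (rule bij_betwI[where g = "block_swap n"]) (auto simp: inv, auto simp: block_swap_def two)
  then have "block_swap n permutes {1..}"
    by (rule bij_imp_permutes) (auto simp: block_swap_def)
  moreover have "{k. block_swap n k \<noteq> k} \<subseteq> {..2 ^ n}"
    by (auto simp: block_swap_def two split: if_splits)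
  ultimately show ?thesis
    by (auto simp: fin_perms_def intro: finite_subset)
qed

text \<open>Since \<open>n < 2 ^ n\<close>, any fixed finite set of sites is eventually moved beyond
  every bound.\<close>

lemma block_swap_gt:
  assumes "1 \<le> k" "k \<le> n" shows "block_swap (Suc n) k = 2 ^ n + k"
proof -
  have "k \<le> 2 ^ n" using assms(2) less_exp[of n] by linarith
  then show ?thesis using assms(1) by (simp add: block_swap_def)
qed


section \<open>The canonical anticommutation relations\<close>

lemma generated_UNIV:
  "car_algebra a \<Longrightarrow> closed S \<Longrightarrow> star_subalgebra S \<Longrightarrow> (\<And>j. j \<ge> 1 \<Longrightarrow> a j \<in> S) \<Longrightarrow> S = UNIV"
  by (simp add: car_algebra_def)

text \<open>Agreement of two automorphisms is a closed condition stable under the *-algebra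
  operations, so it spreads from the generators. This supplies the uniqueness behind
  \<open>THE\<close> in \<open>car_action\<close>.\<close>

lemma aut_eqI:
  fixes \<alpha> \<beta> :: "'a::cstar_algebra \<Rightarrow> 'a"
  assumes a: "car_algebra a" and \<alpha>: "cstar_automorphism \<alpha>" and \<beta>: "cstar_automorphism \<beta>"
    and eq: "\<And>j. j \<ge> 1 \<Longrightarrow> \<alpha> (a j) = \<beta> (a j)"
  shows "\<alpha> = \<beta>"
proof -
  have "closed {x. \<alpha> x = \<beta> x}"
    by (intro closed_Collect_eq aut_continuous \<alpha> \<beta>)
  moreover have "star_subalgebra {x. \<alpha> x = \<beta> x}"
    by (simp add: star_subalgebra_def aut_add[OF \<alpha>] aut_add[OF \<beta>] aut_mult[OF \<alpha>] aut_mult[OF \<beta>]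
        aut_scaleC[OF \<alpha>] aut_scaleC[OF \<beta>] aut_star[OF \<alpha>] aut_star[OF \<beta>] aut_one[OF \<alpha>] aut_one[OF \<beta>])
  ultimately have "{x. \<alpha> x = \<beta> x} = UNIV"
    by (rule generated_UNIV[OF a]) (use eq in simp)
  then show ?thesis by auto
qed

definition mat_unit :: "2 \<Rightarrow> 2 \<Rightarrow> complex^2^2" where
  "mat_unit i j = (\<chi> k l. if k = i \<and> l = j then 1 else 0)"

lemma mat_unit_nth [simp]: "mat_unit i j $ k $ l = (if k = i \<and> l = j then 1 else 0)"
  by (simp add: mat_unit_def)

definition embed_prod :: "(nat \<Rightarrow> 'a::cstar_algebra) \<Rightarrow> (nat \<times> (complex^2^2)) list \<Rightarrow> 'a" where
  "embed_prod a ws = prod_list (map (\<lambda>(j, A). car_embed a j A) ws)"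

lemma embed_prod_simps [simp]:
  "embed_prod a [] = 1" "embed_prod a ((j, A) # ws) = car_embed a j A * embed_prod a ws"
  by (simp_all add: embed_prod_def)

text \<open>These are the words on which a product state is prescribed. The order of the letters
  still matters, because off-diagonal letters at different sites anticommute.\<close>

definition admissible :: "(nat \<times> 'b) list \<Rightarrow> bool" where
  "admissible ws \<longleftrightarrow> distinct (map fst ws) \<and> fst ` set ws \<subseteq> {1..}"

lemma admissible_simps [simp]:
  "admissible []"
  "admissible ((j, A) # ws) \<longleftrightarrow> j \<ge> 1 \<and> j \<notin> fst ` set ws \<and> admissible ws"
  by (auto simp: admissible_def)

definition complex_subspace :: "'a::cstar_algebra set \<Rightarrow> bool" where
  "complex_subspace S \<longleftrightarrow> 0 \<in> S \<and> (\<forall>x\<in>S. \<forall>y\<in>S. x + y \<in> S) \<and> (\<forall>c. \<forall>x\<in>S. c *\<^sub>C x \<in> S)"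

locale car =
  fixes a :: "nat \<Rightarrow> 'a::cstar_algebra"
  assumes car: "car_algebra a"
begin

section \<open>Identities for the generators and implementation of permutations\<close>

lemma double_eq: "x + x = y + y \<Longrightarrow> x = y" for x y :: 'a
  using scaleR_cancel_left[of 2 x y] by (simp add: scaleR_2)

lemma anti:
  assumes "j \<ge> 1" "k \<ge> 1"
  shows "a j * a k + a k * a j = 0" "star (a j) * star (a k) + star (a k) * star (a j) = 0"
    "star (a j) * a k + a k * star (a j) = (if j = k then 1 else 0)"
  using car assms by (auto simp: car_algebra_def anticommutator_def)

lemma a_nilpotent: "j \<ge> 1 \<Longrightarrow> a j * a j = 0"
  using anti(1)[of j j] double_eq[of "a j * a j" 0] by simp

lemma star_a_nilpotent: "j \<ge> 1 \<Longrightarrow> star (a j) * star (a j) = 0"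
  using a_nilpotent[of j] by (metis star_mult star_zero)

lemma a_star_a: "j \<ge> 1 \<Longrightarrow> a j * star (a j) = 1 - star (a j) * a j"
  using anti(3)[of j j] by (simp add: algebra_simps)

lemma a_star_a_a: "j \<ge> 1 \<Longrightarrow> a j * star (a j) * a j = a j"
  by (simp add: a_star_a left_diff_distrib mult.assoc a_nilpotent)

lemma star_a_a_star_a: "j \<ge> 1 \<Longrightarrow> star (a j) * a j * star (a j) = star (a j)"
  by (simp add: a_star_a right_diff_distrib mult.assoc)
    (simp add: star_a_nilpotent flip: mult.assoc)

text \<open>
  The swap is inner: with \<open>d = a i - a j\<close>, the self-adjoint unitary \<open>u = 1 - star d * d\<close>
  conjugates \<open>d\<close> to \<open>- d\<close> and fixes \<open>a i + a j\<close> and all other \<open>a k\<close>.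
\<close>

lemma swap_implemented:
  assumes i: "i \<ge> 1" and j: "j \<ge> 1" and ne: "i \<noteq> j"
  shows "\<exists>\<alpha>. cstar_automorphism \<alpha> \<and> (\<forall>k\<ge>1. \<alpha> (a k) = a (Transposition.transpose i j k))"
proof -
  define d where "d = a i - a j"
  define c where "c = a i + a j"
  define u where "u = 1 - star d * d"
  have dd: "d * d = 0"
  proof -
    have "d * d = a i * a i + a j * a j - (a i * a j + a j * a i)"
      by (simp add: d_def algebra_simps)
    then show ?thesis by (simp add: anti(1)[OF i j] a_nilpotent[OF i] a_nilpotent[OF j])
  qed
  have dsd: "star d * d + d * star d = 2"
  proof -
    have "star d * d + d * star d = (star (a i) * a i + a i * star (a i)) +
        (star (a j) * a j + a j * star (a j)) - (star (a i) * a j + a j * star (a i)) -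
        (star (a j) * a i + a i * star (a j))"
      by (simp add: d_def star_diff algebra_simps)
    then show ?thesis using ne by (simp add: anti(3)[OF i i] anti(3)[OF i j] anti(3)[OF j i] anti(3)[OF j j])
  qed
  have dc: "d * c + c * d = 0"
  proof -
    have "d * c + c * d = (a i * a i + a i * a i) - (a j * a j + a j * a j)"
      by (simp add: d_def c_def algebra_simps)
    then show ?thesis by (simp add: a_nilpotent[OF i] a_nilpotent[OF j])
  qed
  have dsc: "star d * c + c * star d = 0"
  proof -
    have "star d * c + c * star d = (star (a i) * a i + a i * star (a i)) -
        (star (a j) * a j + a j * star (a j)) + (star (a i) * a j + a j * star (a i)) -
        (star (a j) * a i + a i * star (a j))"
      by (simp add: d_def c_def star_diff algebra_simps)
    then show ?thesis using ne by (simp add: anti(3)[OF i i] anti(3)[OF i j] anti(3)[OF j i] anti(3)[OF j j])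
  qed
  have ddsd: "d * star d * d = 2 * d"
  proof -
    have "d * star d = 2 - star d * d" using dsd by (simp add: eq_diff_eq add.commute)
    then show ?thesis by (simp add: left_diff_distrib mult.assoc dd)
  qed
  have su: "star u = u" by (simp add: u_def star_diff star_mult star_star)
  \<comment> \<open>Thus \<open>star d * d\<close> is twice a projection, and \<open>u\<close> is
    the corresponding reflection.\<close>
  have "star d * d * (star d * d) = 2 * (star d * d)"
    by (metis ddsd mult.assoc mult_2 mult_2_right distrib_left)
  then have uu: "u * u = 1" by (simp add: u_def algebra_simps mult_2)
  have ud: "u * d = d" by (simp add: u_def left_diff_distrib mult.assoc dd)
  have du: "d * u = - d" using ddsd by (simp add: u_def right_diff_distrib mult_2 flip: mult.assoc)
  \<comment> \<open>\<open>star d * d\<close> is even, so \<open>u\<close> commutes with everything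
    that anticommutes with both \<open>d\<close> and \<open>star d\<close>.\<close>
  have comm: "u * x = x * u" if "d * x + x * d = 0" "star d * x + x * star d = 0" for x
  proof -
    have "x * star d = - (star d * x)" "x * d = - (d * x)"
      using that by (simp_all add: eq_neg_iff_add_eq_0 add.commute)
    then have "star d * d * x = x * (star d * d)"
      by (rule anticommute_mult[symmetric])
    then show ?thesis by (simp add: u_def algebra_simps)
  qed
  have udu: "u * d * u = - d" by (simp add: ud du)
  have ucu: "u * c * u = c" using comm[OF dc dsc] uu by (simp add: mult.assoc)
  have "u * a k * u = a (Transposition.transpose i j k)" if k: "k \<ge> 1" for k
  proof -
    consider "k = i" | "k = j" | "k \<noteq> i" "k \<noteq> j" by blast
    then show ?thesis
    proof cases
      case 1
      \<comment> \<open>Twice \<open>a i\<close> is \<open>c + d\<close>, which conjugation sends to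
        \<open>c - d\<close>, twice \<open>a j\<close>; working with doubles avoids
        division.\<close>
      have "u * a i * u + u * a i * u = a j + a j"
      proof -
        have "u * a i * u + u * a i * u = u * c * u + u * d * u"
          by (simp add: d_def c_def algebra_simps)
        also have "\<dots> = a j + a j" unfolding udu ucu by (simp add: d_def c_def)
        finally show ?thesis .
      qed
      then show ?thesis using double_eq 1 by (metis transpose_apply_first transpose_apply_second)
    next
      case 2
      have "u * a j * u + u * a j * u = a i + a i"
      proof -
        have "u * a j * u + u * a j * u = u * c * u - u * d * u"
          by (simp add: d_def c_def algebra_simps)
        also have "\<dots> = a i + a i" unfolding udu ucu by (simp add: d_def c_def)
        finally show ?thesis .
      qed
      then show ?thesis using double_eq 2 by (metis transpose_apply_first transpose_apply_second)
    next
      case 3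
      have "d * a k + a k * d = (a i * a k + a k * a i) - (a j * a k + a k * a j)"
        by (simp add: d_def algebra_simps)
      then have "d * a k + a k * d = 0" by (simp add: anti(1)[OF i k] anti(1)[OF j k])
      moreover have "star d * a k + a k * star d =
          (star (a i) * a k + a k * star (a i)) - (star (a j) * a k + a k * star (a j))"
        by (simp add: d_def star_diff algebra_simps)
      then have "star d * a k + a k * star d = 0"
        using 3 by (simp add: anti(3)[OF i k] anti(3)[OF j k])
      ultimately have "u * a k * u = a k" using comm uu by (simp add: mult.assoc)
      then show ?thesis using 3 by simp
    qed
  qed
  with aut_conjugation[OF su uu] show ?thesis by blast
qed

text \<open>Transpositions generate the permutations of the finite support of \<open>g\<close>;
  composing their implementing automorphisms gives one for \<open>g\<close>.\<close>

lemma perm_implemented: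
  assumes "g \<in> fin_perms"
  shows "\<exists>\<alpha>. cstar_automorphism \<alpha> \<and> (\<forall>k\<ge>1. \<alpha> (a k) = a (g k))"
proof -
  define S where "S = {k. g k \<noteq> k}"
  have S: "finite S" "S \<subseteq> {1..}" "g permutes S"
    using assms by (auto simp: fin_perms_def S_def permutes_def)
  show ?thesis using S(3,1)
  proof (induction rule: permutes_induct)
    case id
    show ?case using aut_id by force
  next
    case (swap i j p)
    then have "i \<ge> 1" "j \<ge> 1" using S(2) by auto
    with swap.hyps obtain \<alpha> where \<alpha>: "cstar_automorphism \<alpha>" "\<forall>k\<ge>1. \<alpha> (a k) = a (Transposition.transpose i j k)"
      using swap_implemented by blast
    obtain \<beta> where \<beta>: "cstar_automorphism \<beta>" "\<forall>k\<ge>1. \<beta> (a k) = a (p k)"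
      using swap by blast
    have "p k \<ge> 1" if "k \<ge> 1" for k
      using permutes_in_image[OF permutes_subset[OF \<open>p permutes S\<close> S(2)], of k] that by simp
    then have "\<forall>k\<ge>1. (\<alpha> \<circ> \<beta>) (a k) = a ((Transposition.transpose i j \<circ> p) k)"
      using \<alpha> \<beta> by simp
    with aut_compose[OF \<alpha>(1) \<beta>(1)] show ?case by blast
  qed
qed

lemma car_action:
  assumes "g \<in> fin_perms"
  shows "cstar_automorphism (car_action a g)" "\<And>j. j \<ge> 1 \<Longrightarrow> car_action a g (a j) = a (g j)"
proof -
  obtain \<alpha> where \<alpha>: "cstar_automorphism \<alpha>" "\<forall>j\<ge>1. \<alpha> (a j) = a (g j)"
    using perm_implemented[OF assms] by blast
  have "cstar_automorphism (car_action a g) \<and> (\<forall>j\<ge>1. car_action a g (a j) = a (g j))"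
    unfolding car_action_def
  proof (rule theI[where a = \<alpha>])
    fix \<beta> assume "cstar_automorphism \<beta> \<and> (\<forall>j\<ge>1. \<beta> (a j) = a (g j))"
    with \<alpha> show "\<beta> = \<alpha>" by (intro aut_eqI[OF car]) auto
  qed (use \<alpha> in blast)
  then show "cstar_automorphism (car_action a g)" "\<And>j. j \<ge> 1 \<Longrightarrow> car_action a g (a j) = a (g j)"
    by auto
qed

lemma car_action_embed:
  assumes g: "g \<in> fin_perms" and "j \<ge> 1"
  shows "car_action a g (car_embed a j A) = car_embed a (g j) A"
  using assms car_action[OF g]
  by (simp add: car_embed_def aut_add aut_mult aut_scaleC aut_star)

lemma car_action_embed_prod:
  assumes g: "g \<in> fin_perms" and "fst ` set ws \<subseteq> {1..}"
  shows "car_action a g (embed_prod a ws) = embed_prod a (map (map_prod g id) ws)"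
  using assms(2)
  by (induction ws) (auto simp: aut_one[OF car_action(1)] aut_mult[OF car_action(1)] g car_action_embed)

section \<open>Calculus and density of words in embedded matrices\<close>

lemma embed_mult:
  assumes j: "j \<ge> 1"
  shows "car_embed a j A * car_embed a j B = car_embed a j (A ** B)"
proof -
  define x where "x = a j"
  define y where "y = star (a j)"
  have "x * x = 0" "y * y = 0" "x * y * x = x" "y * x * y = y"
    using j by (simp_all add: x_def y_def a_nilpotent star_a_nilpotent a_star_a_a star_a_a_star_a)
  \<comment> \<open>Copies with a trailing factor \<open>z\<close> let the relations act inside
    right-associated products.\<close>
  moreover from this have "x * (x * z) = 0" "y * (y * z) = 0" "x * (y * (x * z)) = x * z"
    "y * (x * (y * z)) = y * z" for z
    by (metis mult.assoc mult_zero_left)+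
  ultimately show ?thesis
    unfolding car_embed_def y_def[symmetric] unfolding x_def[symmetric]
    by (simp add: matrix_matrix_mult_def sum_2 distrib_left distrib_right mult_scaleC_left
        mult_scaleC_right scaleC_scaleC scaleC_add_left scaleC_add_right ac_simps)
qed

lemma embed_star: "star (car_embed a j A) = car_embed a j (adjoint_mat A)"
  by (simp add: car_embed_def adjoint_mat_def star_add star_scaleC star_mult star_star)

lemma embed_units:
  "car_embed a j (mat_unit 1 2) = a j" "car_embed a j (mat_unit 2 1) = star (a j)"
  "car_embed a j (mat_unit 2 2) = star (a j) * a j"
  by (simp_all add: car_embed_def)

text \<open>Moving \<open>x\<close> past site \<open>k\<close> flips the sign of the two
  off-diagonal matrix units and leaves the diagonal ones alone, which is exactly the
  grading.\<close>

lemma embed_graded_commute: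
  assumes "x * a k = - (a k * x)" "x * star (a k) = - (star (a k) * x)"
  shows "x * car_embed a k A = car_embed a k (mat2_grading A) * x"
proof -
  have "x * (a k * star (a k)) = a k * star (a k) * x" "x * (star (a k) * a k) = star (a k) * a k * x"
    using assms by (auto intro!: anticommute_mult)
  with assms show ?thesis
    by (simp add: car_embed_def mat2_grading_def distrib_left distrib_right
        left_diff_distrib right_diff_distrib mult_scaleC_left mult_scaleC_right)
qed

text \<open>A factor at a fresh site is prepended. Otherwise it moves right through the word,
  grading each letter it passes, until it reaches its own site and is absorbed by
  \<open>embed_mult\<close>; the list of sites stays the same.\<close>

lemma embed_times_embed_prod:
  assumes j: "j \<ge> 1" and x: "x = car_embed a j B"
    and comm: "\<And>k A. k \<ge> 1 \<Longrightarrow> k \<noteq> j \<Longrightarrow> x * car_embed a k A = car_embed a k (mat2_grading A) * x"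
    and ws: "admissible ws"
  shows "\<exists>ws'. admissible ws' \<and> x * embed_prod a ws = embed_prod a ws'"
proof (cases "j \<in> fst ` set ws")
  case False
  then show ?thesis using j ws x by (intro exI[of _ "(j, B) # ws"]) simp
next
  case True
  then have "\<exists>ws'. map fst ws' = map fst ws \<and> x * embed_prod a ws = embed_prod a ws'"
    using ws
  proof (induction ws)
    case (Cons w ws)
    obtain k A where w: "w = (k, A)" by (cases w)
    show ?case
    proof (cases "k = j")
      case True
      then show ?thesis
        using embed_mult[OF j, of B A]
        by (intro exI[of _ "(j, B ** A) # ws"]) (simp add: w x flip: mult.assoc)
    next
      case False
      with Cons w obtain ws' where ws': "map fst ws' = map fst ws" "x * embed_prod a ws = embed_prod a ws'" by auto
      have "x * embed_prod a (w # ws) = embed_prod a ((k, mat2_grading A) # ws')"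
        using comm[of k A] False Cons.prems w by (simp flip: ws'(2) mult.assoc)
      then show ?thesis using ws' w by (intro exI[of _ "(k, mat2_grading A) # ws'"]) simp
    qed
  qed simp
  then obtain ws' where "map fst ws' = map fst ws" "x * embed_prod a ws = embed_prod a ws'" by blast
  moreover from this have "admissible ws'"
    using ws by (metis admissible_def image_set)
  ultimately show ?thesis by blast
qed

lemma generator_times_embed_prod:
  assumes j: "j \<ge> 1" and ws: "admissible ws"
  shows "\<exists>ws'. admissible ws' \<and> a j * embed_prod a ws = embed_prod a ws'"
    "\<exists>ws'. admissible ws' \<and> star (a j) * embed_prod a ws = embed_prod a ws'"
proof -
  have "a j * car_embed a k A = car_embed a k (mat2_grading A) * a j" if "k \<ge> 1" "k \<noteq> j" for k A
    using anti(1)[OF j that(1)] anti(3)[OF that(1) j] that(2)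
    by (intro embed_graded_commute) (simp_all add: add_eq_0_iff2 add_eq_0_iff)
  then show "\<exists>ws'. admissible ws' \<and> a j * embed_prod a ws = embed_prod a ws'"
    using embed_times_embed_prod[OF j embed_units(1)[symmetric] _ ws] by blast
  have "star (a j) * car_embed a k A = car_embed a k (mat2_grading A) * star (a j)"
    if "k \<ge> 1" "k \<noteq> j" for k A
    using anti(2)[OF j that(1)] anti(3)[OF j that(1)] that(2)
    by (intro embed_graded_commute) (simp_all add: add_eq_0_iff2 add_eq_0_iff)
  then show "\<exists>ws'. admissible ws' \<and> star (a j) * embed_prod a ws = embed_prod a ws'"
    using embed_times_embed_prod[OF j embed_units(2)[symmetric] _ ws] by blast
qed

text \<open>Left multiplication by a generator or its adjoint maps words to words, so the
  multipliers of the closed span form a closed *-subalgebra containing all generators, hence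
  everything. Applying them to the unit, which is the empty word, gives density.\<close>

lemma embed_prod_dense:
  assumes cl: "closed S" and sub: "complex_subspace S"
    and mono: "\<And>ws. admissible ws \<Longrightarrow> embed_prod a ws \<in> S"
  shows "x \<in> S"
proof -
  \<comment> \<open>The intersection of the sets in \<open>\<F>\<close> is the closed complex span
    of the words.\<close>
  define \<F> where "\<F> = {V. closed V \<and> complex_subspace V \<and> (\<forall>ws. admissible ws \<longrightarrow> embed_prod a ws \<in> V)}"
  define D where "D = \<Inter>\<F>"
  have D: "closed D" "complex_subspace D" "\<And>ws. admissible ws \<Longrightarrow> embed_prod a ws \<in> D"
    unfolding D_def \<F>_def complex_subspace_def by (auto intro!: closed_Inter)
  have gen: "x * d \<in> D"
    if x: "\<And>ws. admissible ws \<Longrightarrow> \<exists>ws'. admissible ws' \<and> x * embed_prod a ws = embed_prod a ws'" and d: "d \<in> D" for x d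
  proof -
    have "{d. x * d \<in> D} \<in> \<F>"
      unfolding \<F>_def
    proof (safe)
      show "closed {d. x * d \<in> D}"
        using closed_vimage[OF D(1), of "\<lambda>d. x * d"]
        by (simp add: vimage_def continuous_intros)
      show "complex_subspace {d. x * d \<in> D}"
        using D(2) by (simp add: complex_subspace_def distrib_left mult_scaleC_right)
    next
      fix ws :: "(nat \<times> (complex^2^2)) list" assume "admissible ws"
      then show "x * embed_prod a ws \<in> D" using x D(3) by metis
    qed
    then show ?thesis using d by (auto simp: D_def)
  qed
  \<comment> \<open>Both \<open>x\<close> and \<open>star x\<close> are required to preserve
    \<open>D\<close>, so that \<open>T\<close> is closed under adjoints.\<close>
  define T where "T = (\<Inter>d\<in>D. {x. x * d \<in> D} \<inter> {x. star x * d \<in> D})"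
  have "closed {x. x * d \<in> D}" "closed {x. star x * d \<in> D}" for d
    using closed_vimage[OF D(1), of "\<lambda>x. x * d"] closed_vimage[OF D(1), of "\<lambda>x. star x * d"]
    by (simp_all add: vimage_def continuous_intros)
  then have "closed T" unfolding T_def by (intro closed_INT closed_Int ballI)
  moreover have "star_subalgebra T"
    using D(2) unfolding T_def star_subalgebra_def complex_subspace_def
    by (simp add: star_add star_mult star_scaleC star_star distrib_right mult_scaleC_left mult.assoc)
  moreover have "a j \<in> T" if "j \<ge> 1" for j
    using gen generator_times_embed_prod[OF that] unfolding T_def by blast
  ultimately have "T = UNIV" by (rule generated_UNIV[OF car])
  moreover have "1 \<in> D" using D(3)[of "[]"] by simp
  ultimately have "x * 1 \<in> D" unfolding T_def by blast
  then show ?thesis using cl sub mono by (auto simp: D_def \<F>_def)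
qed

end

section \<open>Symmetric states and product states\<close>

lemma embed_prod_append: "embed_prod a (vs @ ws) = embed_prod a vs * embed_prod a ws"
  by (simp add: embed_prod_def)

lemma tendsto_zero_complex_subspace:
  fixes T :: "nat \<Rightarrow> 'a::cstar_algebra \<Rightarrow> complex"
  assumes add: "\<And>k x y. T k (x + y) = T k x + T k y" and scale: "\<And>k c x. T k (c *\<^sub>C x) = c * T k x"
  shows "complex_subspace {x. (\<lambda>k. T k x) \<longlonglongrightarrow> 0}"
proof -
  have "T k 0 = 0" for k using add[of k 0 0] by simp
  then show ?thesis
    using tendsto_add[of "\<lambda>k. T k x" 0 _ "\<lambda>k. T k y" 0 for x y] tendsto_mult_right_zero
    by (auto simp: complex_subspace_def add scale)
qed

lemma fresh_above:
  obtains M where "\<And>k. k > M \<Longrightarrow> k \<notin> fst ` set (ws :: (nat \<times> 'b) list)"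
proof -
  have "finite (fst ` set ws)" by simp
  then obtain M where "\<forall>k\<in>fst ` set ws. k \<le> M" using finite_nat_set_iff_bounded_le by blast
  then show ?thesis using that by (meson not_less)
qed

text \<open>The pivot of all implications. In a symmetric state the odd letters vanish, so this
  recursion with its single parameter \<open>p\<close> fixes the values on all words.\<close>

definition number_factorizes :: "(nat \<Rightarrow> 'a::cstar_algebra) \<Rightarrow> complex \<Rightarrow> ('a \<Rightarrow>\<^sub>L complex) \<Rightarrow> bool" where
  "number_factorizes a p \<phi> \<longleftrightarrow> (\<forall>j ws. j \<ge> 1 \<and> j \<notin> fst ` set ws \<and> admissible ws \<longrightarrow>
     \<phi> (star (a j) * a j * embed_prod a ws) = p * \<phi> (embed_prod a ws))"

text \<open>The functional with density matrix diag(1 - p, p): \<open>p\<close> is the weight of the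
  occupied level, since \<open>car_embed\<close> sends the second diagonal unit to
  \<open>star (a j) * a j\<close>.\<close>

definition diag_functional :: "complex \<Rightarrow> complex^2^2 \<Rightarrow> complex" where
  "diag_functional p A = A $ 1 $ 1 * (1 - p) + A $ 2 $ 2 * p"

context car
begin

section \<open>Number operators and sums of annihilators\<close>

lemma number_selfadjoint: "star (star (a j) * a j) = star (a j) * a j"
  by (simp add: star_mult star_star)

lemma number_idem: "j \<ge> 1 \<Longrightarrow> star (a j) * a j * (star (a j) * a j) = star (a j) * a j"
  using star_a_a_star_a[of j] by (simp flip: mult.assoc)

lemma norm_number_le: 
  assumes "j \<ge> 1" shows "norm (star (a j) * a j) \<le> 1"
proof -
  have "(norm (star (a j) * a j))\<^sup>2 = norm (star (a j) * a j)"
    using norm_star_mult_self[of "star (a j) * a j"] by (simp only: number_selfadjoint number_idem assms)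
  then show ?thesis by (metis mult_cancel_left2 order_refl power2_eq_square zero_le_one)
qed

lemma number_commute_embed_prod:
  assumes "k \<ge> 1" "k \<notin> fst ` set ws" "admissible ws"
  shows "embed_prod a ws * (star (a k) * a k) = star (a k) * a k * embed_prod a ws"
  using assms(2,3)
proof (induction ws)
  case (Cons w ws)
  obtain j A where w: "w = (j, A)" by (cases w)
  have j: "j \<ge> 1" "j \<noteq> k" using Cons.prems w by auto
  have 1: "a j * (star (a k) * a k) = star (a k) * a k * a j"
    using anti(1)[OF j(1) assms(1)] anti(3)[OF assms(1) j(1)] j(2)
    by (intro anticommute_mult) (auto simp: eq_neg_iff_add_eq_0 add.commute)
  have 2: "star (a j) * (star (a k) * a k) = star (a k) * a k * star (a j)"
    using 1 by (metis number_selfadjoint star_mult)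
  have 3: "x * y * n = n * (x * y)" if "x * n = n * x" "y * n = n * y" for x y n :: 'a
    using that by (metis mult.assoc)
  have "car_embed a j A * (star (a k) * a k) = star (a k) * a k * car_embed a j A"
    unfolding car_embed_def
    using 3[OF 1 2] 3[OF 2 1] 1 2
    by (simp add: distrib_left distrib_right mult_scaleC_left mult_scaleC_right)
  moreover have "embed_prod a ws * (star (a k) * a k) = star (a k) * a k * embed_prod a ws"
    using Cons w by simp
  ultimately show ?case using 3 by (simp add: w)
qed simp

text \<open>The sum \<open>x\<close> behaves like \<open>sqrt N\<close> times one annihilator:
  \<open>x * x = 0\<close> and its anticommutator with \<open>star x\<close> is
  \<open>N = card F\<close>. Hence \<open>y = star x * x\<close> satisfies
  \<open>y * y = N * y\<close>, which bounds \<open>norm y\<close> by \<open>N\<close>.\<close>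

lemma norm_sum_annihilators_le:
  assumes F: "finite F" "F \<subseteq> {1..}"
  shows "(norm (\<Sum>i\<in>F. a i))\<^sup>2 \<le> card F"
proof -
  define x where "x = (\<Sum>i\<in>F. a i)"
  have "x * x = (\<Sum>i\<in>F. \<Sum>j\<in>F. a i * a j)" by (simp add: x_def sum_product)
  moreover have "x * x = (\<Sum>i\<in>F. \<Sum>j\<in>F. a j * a i)"
    using calculation by (subst sum.swap) simp
  ultimately have "x * x + x * x = (\<Sum>i\<in>F. \<Sum>j\<in>F. a i * a j + a j * a i)"
    by (simp add: sum.distrib)
  also have "\<dots> = 0" using F(2) anti(1) by (intro sum.neutral ballI) auto
  finally have xx: "x * x = 0" using double_eq[of "x * x" 0] by simp
  have "star x * x = (\<Sum>i\<in>F. \<Sum>j\<in>F. star (a i) * a j)" by (simp add: x_def sum_product star_sum)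
  moreover have "x * star x = (\<Sum>i\<in>F. \<Sum>j\<in>F. a j * star (a i))"
    by (subst sum.swap) (simp add: x_def sum_product star_sum)
  ultimately have "star x * x + x * star x = (\<Sum>i\<in>F. \<Sum>j\<in>F. star (a i) * a j + a j * star (a i))"
    by (simp add: sum.distrib)
  also have "\<dots> = (\<Sum>i\<in>F. \<Sum>j\<in>F. if i = j then 1 else 0)"
    using F(2) by (intro sum.cong refl anti(3)) auto
  also have "\<dots> = of_nat (card F)" using F(1) by simp
  finally have xsx: "x * star x = of_nat (card F) - star x * x" by (simp add: algebra_simps)
  define y where "y = star x * x"
  have "star y * y = star x * (x * star x) * x" by (simp add: y_def star_mult star_star mult.assoc)
  also have "\<dots> = of_nat (card F) * y"
    by (simp add: xsx left_diff_distrib right_diff_distrib mult.assoc xx y_def mult_of_nat_commute)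
  finally have "(norm y)\<^sup>2 = norm (of_nat (card F) * y)" using norm_star_mult_self[of y] by simp
  also have "\<dots> \<le> card F * norm y" by (metis norm_mult_ineq norm_of_nat)
  finally have "norm y * norm y \<le> card F * norm y" by (simp add: power2_eq_square)
  then have "norm y \<le> card F" by (smt (verit) mult_right_le_imp_le norm_ge_zero of_nat_0_le_iff)
  then show ?thesis by (simp add: y_def norm_star_mult_self flip: x_def)
qed

lemma blinfun_eq_if_eq_on_embed_prod:
  assumes \<phi>: "state \<phi>" and \<psi>: "state \<psi>" and eq: "\<And>ws. admissible ws \<Longrightarrow> \<phi> (embed_prod a ws) = \<psi> (embed_prod a ws)"
  shows "\<phi> = \<psi>"
proof (rule blinfun_eqI)
  fix x
  have "x \<in> {x. \<phi> x = \<psi> x}"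
  proof (rule embed_prod_dense)
    show "closed {x. \<phi> x = \<psi> x}" by (intro closed_Collect_eq continuous_intros)
    show "complex_subspace {x. \<phi> x = \<psi> x}"
      by (simp add: complex_subspace_def blinfun.add_right state_scaleC[OF \<phi>] state_scaleC[OF \<psi>])
  qed (simp add: eq)
  then show "\<phi> x = \<psi> x" by simp
qed

section \<open>Product states and clustering\<close>

lemma product_state_apply:
  assumes "is_product_state a \<rho> \<phi>" "admissible ws"
  shows "\<phi> (embed_prod a ws) = prod_list (map (\<lambda>(j, A). \<rho> A) ws)"
proof -
  have "\<phi> (prod_list (map2 (car_embed a) (map fst ws) (map snd ws))) = prod_list (map \<rho> (map snd ws))"
    using assms by (auto simp: is_product_state_def admissible_def)
  then show ?thesis by (simp add: embed_prod_def zip_map_fst_snd comp_def case_prod_unfold)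
qed

text \<open>On words the correlation factorizes exactly once the swap has carried the first word
  past all sites of the second. Bounds uniform in \<open>n\<close> extend the limit by density, one
  variable at a time.\<close>

lemma product_state_strongly_clustering:
  assumes pr: "is_product_state a \<rho> \<phi>"
  shows "strongly_clustering a \<phi>"
proof -
  have st: "state \<phi>" using pr by (simp add: is_product_state_def)
  define T where "T x y n = \<phi> (car_action a (block_swap (Suc n)) x * y) - \<phi> x * \<phi> y" for x y n
  note aut = car_action(1)[OF block_swap_fin_perms]
  have act_norm: "norm (\<phi> (car_action a (block_swap (Suc n)) x * y)) \<le> norm \<phi> * (norm x * norm y)" for n x y
  proof -
    have "norm (car_action a (block_swap (Suc n)) x * y) \<le> norm x * norm y"
      using norm_mult_ineq[of "car_action a (block_swap (Suc n)) x" y] by (simp add: aut_norm[OF aut])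
    then show ?thesis by (meson mult_left_mono norm_blinfun norm_ge_zero order_trans)
  qed
  have prod_norm: "norm (\<phi> x * \<phi> y) \<le> norm \<phi> * norm \<phi> * (norm x * norm y)" for x y
    using mult_mono[OF norm_blinfun[of \<phi> x] norm_blinfun[of \<phi> y]] by (simp add: norm_mult ac_simps)
  have bound: "norm (T x y n) \<le> (norm \<phi> + norm \<phi> * norm \<phi>) * (norm x * norm y)" for x y n
    unfolding T_def using act_norm[of n x y] prod_norm[of x y]
      norm_triangle_ineq4[of "\<phi> (car_action a (block_swap (Suc n)) x * y)" "\<phi> x * \<phi> y"]
    by (simp add: distrib_right)
  have ev: "(\<lambda>n. T (embed_prod a ws) (embed_prod a vs) n) \<longlonglongrightarrow> 0"
    if ws: "admissible ws" and vs: "admissible vs" for ws vs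
  proof -
    obtain M1 where M1: "\<And>k. k > M1 \<Longrightarrow> k \<notin> fst ` set ws" using fresh_above by blast
    obtain M2 where M2: "\<And>k. k > M2 \<Longrightarrow> k \<notin> fst ` set vs" using fresh_above by blast
    \<comment> \<open>From \<open>M1\<close> on all sites of \<open>ws\<close> lie in the swapped
      block, and from \<open>M2\<close> on their images avoid \<open>vs\<close>.\<close>
    have "T (embed_prod a ws) (embed_prod a vs) n = 0" if n: "n \<ge> max M1 M2" for n
    proof -
      define g where "g = block_swap (Suc n)"
      have g: "g \<in> fin_perms" by (simp add: g_def block_swap_fin_perms)
      have gw: "g j = 2 ^ n + j" if "j \<in> fst ` set ws" for j
      proof -
        have "1 \<le> j" using ws that by (auto simp: admissible_def)
        moreover have "j \<le> n" using M1[of j] that n by (meson max.boundedE not_le order_trans)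
        ultimately show ?thesis by (simp add: g_def block_swap_gt)
      qed
      have fresh: "2 ^ n + j \<notin> fst ` set vs" for j
        using n less_exp[of n] by (intro M2) linarith
      have "admissible (map (map_prod g id) ws @ vs)"
      proof -
        have "distinct (map g (map fst ws))"
          using ws gw by (auto simp: distinct_map admissible_def inj_on_def)
        moreover have "g ` fst ` set ws \<inter> fst ` set vs = {}" using gw fresh by force
        ultimately show ?thesis
          using ws vs fin_perms_ge1[OF g] by (force simp: admissible_def comp_def image_image)
      qed
      then have "\<phi> (embed_prod a (map (map_prod g id) ws @ vs)) =
          prod_list (map (\<lambda>(j, A). \<rho> A) (map (map_prod g id) ws @ vs))"
        by (rule product_state_apply[OF pr])
      also have "\<dots> = \<phi> (embed_prod a ws) * \<phi> (embed_prod a vs)"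
        using product_state_apply[OF pr] ws vs by (simp add: comp_def case_prod_unfold)
      finally show ?thesis
        using car_action_embed_prod[OF g, of ws] ws
        by (simp add: T_def g_def admissible_def embed_prod_append)
    qed
    then show ?thesis by (intro tendsto_eventually eventually_sequentiallyI)
  qed
  have lin1: "T (x + x') y n = T x y n + T x' y n" "T (x - x') y n = T x y n - T x' y n"
    "T (c *\<^sub>C x) y n = c * T x y n" for x x' y n c
    using aut[of "Suc n"]
    by (simp_all add: T_def aut_add aut_diff aut_scaleC blinfun.add_right blinfun.diff_right state_scaleC[OF st]
      algebra_simps mult_scaleC_left)
  have lin2: "T x (y + y') n = T x y n + T x y' n" "T x (y - y') n = T x y n - T x y' n"
    "T x (c *\<^sub>C y) n = c * T x y n" for x y y' n c
    by (simp_all add: T_def blinfun.add_right blinfun.diff_right state_scaleC[OF st]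
      algebra_simps mult_scaleC_right)
  have ev1: "(\<lambda>n. T x (embed_prod a vs) n) \<longlonglongrightarrow> 0" if vs: "admissible vs" for x vs
  proof -
    have "x \<in> {x. (\<lambda>n. T x (embed_prod a vs) n) \<longlonglongrightarrow> 0}"
    proof (rule embed_prod_dense)
      show "closed {x. (\<lambda>n. T x (embed_prod a vs) n) \<longlonglongrightarrow> 0}"
        using bound[of _ "embed_prod a vs"]
        by (intro tendsto_zero_closed[where C = "(norm \<phi> + norm \<phi> * norm \<phi>) * norm (embed_prod a vs)"])
          (simp_all add: lin1 ac_simps)
      show "complex_subspace {x. (\<lambda>n. T x (embed_prod a vs) n) \<longlonglongrightarrow> 0}"
        by (intro tendsto_zero_complex_subspace lin1)
    qed (simp add: ev vs)
    then show ?thesis by simp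
  qed
  have "(\<lambda>n. T x y n) \<longlonglongrightarrow> 0" for x y
  proof -
    have "y \<in> {y. (\<lambda>n. T x y n) \<longlonglongrightarrow> 0}"
    proof (rule embed_prod_dense)
      show "closed {y. (\<lambda>n. T x y n) \<longlonglongrightarrow> 0}"
        using bound[of x]
        by (intro tendsto_zero_closed[where C = "(norm \<phi> + norm \<phi> * norm \<phi>) * norm x"])
          (simp_all add: lin2 ac_simps)
      show "complex_subspace {y. (\<lambda>n. T x y n) \<longlonglongrightarrow> 0}"
        by (intro tendsto_zero_complex_subspace lin2)
    qed (simp add: ev1)
    then show ?thesis by simp
  qed
  then have "(\<lambda>n. \<phi> (car_action a (block_swap (Suc n)) x * y)) \<longlonglongrightarrow> \<phi> x * \<phi> y" for x y
    by (simp add: T_def LIM_zero_iff)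
  then have "(\<lambda>n. \<phi> (car_action a (block_swap n) x * y)) \<longlonglongrightarrow> \<phi> x * \<phi> y" for x y
    by (rule LIMSEQ_imp_Suc)
  then show ?thesis by (simp add: strongly_clustering_def)
qed

section \<open>Consequences of permutation symmetry\<close>

context
  fixes \<phi> :: "'a \<Rightarrow>\<^sub>L complex"
  assumes sym: "\<phi> \<in> symmetric_states a"
begin

lemma sym_state: "state \<phi>"
  using sym by (simp add: symmetric_states_def)

lemma sym_action: "g \<in> fin_perms \<Longrightarrow> \<phi> (car_action a g x) = \<phi> x"
  using sym by (simp add: symmetric_states_def)

text \<open>The transposition of \<open>i\<close> and \<open>k\<close> fixes every site of
  \<open>ws\<close>, so invariance lets one free site replace another.\<close>

lemma sym_fresh:
  assumes i: "i \<ge> 1" "i \<notin> fst ` set ws" and k: "k \<ge> 1" "k \<notin> fst ` set ws" and ws: "admissible ws"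
  shows "\<phi> (car_embed a i A * embed_prod a ws) = \<phi> (car_embed a k A * embed_prod a ws)"
proof -
  define g where "g = Transposition.transpose i k"
  have g: "g \<in> fin_perms" using i k by (simp add: g_def transpose_fin_perms)
  have "map (map_prod g id) ws = ws"
    using i k by (intro map_idI) (force simp: g_def Transposition.transpose_def)
  then have "car_action a g (car_embed a i A * embed_prod a ws) = car_embed a k A * embed_prod a ws"
    using car_action_embed_prod[OF g, of ws] ws i
    by (simp add: aut_mult[OF car_action(1)[OF g]] car_action_embed[OF g] admissible_def)
      (simp add: g_def)
  then show ?thesis using sym_action[OF g] by metis
qed

lemma sym_average:
  assumes j: "j \<ge> 1" "j \<notin> fst ` set ws" and F: "finite F" "F \<subseteq> {1..}" "F \<inter> fst ` set ws = {}" and ws: "admissible ws"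
  shows "\<phi> ((\<Sum>i\<in>F. car_embed a i A) * embed_prod a ws) = of_nat (card F) * \<phi> (car_embed a j A * embed_prod a ws)"
proof -
  have "\<phi> ((\<Sum>i\<in>F. car_embed a i A) * embed_prod a ws) = (\<Sum>i\<in>F. \<phi> (car_embed a i A * embed_prod a ws))"
    by (simp add: sum_distrib_right blinfun.sum_right)
  also have "\<dots> = (\<Sum>i\<in>F. \<phi> (car_embed a j A * embed_prod a ws))"
    using F(2,3) by (intro sum.cong refl sym_fresh) (use j ws in auto)
  finally show ?thesis by simp
qed

text \<open>
  The mean of \<open>N\<close> annihilators has norm at most \<open>1 / sqrt N\<close>, since
  their sum squares to zero and has anticommutator \<open>N\<close> with its adjoint.
\<close>

lemma sym_odd_zero_aux:
  assumes j: "j \<ge> 1" "j \<notin> fst ` set ws" and ws: "admissible ws"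
    and bound: "\<And>F. finite F \<Longrightarrow> F \<subseteq> {1..} \<Longrightarrow> (norm (\<Sum>i\<in>F. car_embed a i A))\<^sup>2 \<le> card F"
  shows "\<phi> (car_embed a j A * embed_prod a ws) = 0"
proof -
  obtain M where M: "\<And>k. k > M \<Longrightarrow> k \<notin> fst ` set ws" using fresh_above by blast
  define c where "c = norm (\<phi> (car_embed a j A * embed_prod a ws))"
  define K where "K = norm \<phi> * norm (embed_prod a ws)"
  \<comment> \<open>With \<open>N\<close> fresh sites the sum has norm at most
    \<open>sqrt N\<close>, so \<open>N * c\<close> is at most \<open>K * sqrt N\<close>; squaring
    and cancelling one \<open>N\<close> leaves a bound independent of \<open>N\<close>.\<close>
  have "real N * c\<^sup>2 \<le> K\<^sup>2" for N
  proof (cases "N = 0")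
    case False
    define F where "F = {M<..M + N}"
    define x where "x = (\<Sum>i\<in>F. car_embed a i A)"
    have F: "finite F" "F \<subseteq> {1..}" "F \<inter> fst ` set ws = {}" "card F = N"
      using M by (force simp: F_def)+
    have "real N * c = norm (\<phi> (x * embed_prod a ws))"
      using sym_average[OF j F(1-3) ws] by (simp add: c_def x_def F(4) norm_mult)
    also have "\<dots> \<le> norm \<phi> * (norm x * norm (embed_prod a ws))"
      by (meson mult_left_mono norm_blinfun norm_ge_zero norm_mult_ineq order_trans)
    also have "\<dots> = K * norm x" by (simp add: K_def)
    finally have "(real N * c)\<^sup>2 \<le> (K * norm x)\<^sup>2"
      by (intro power_mono) (auto simp: c_def)
    also have "\<dots> \<le> K\<^sup>2 * real N"
      using bound[OF F(1,2)] by (simp add: power_mult_distrib x_def F(4) mult_left_mono)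
    finally show ?thesis using False by (simp add: power2_eq_square ac_simps)
  qed simp
  then have "c\<^sup>2 \<le> 0" by (rule nat_mult_bounded_imp_nonpos)
  then show ?thesis by (simp add: c_def)
qed

lemma sym_odd_zero:
  assumes j: "j \<ge> 1" "j \<notin> fst ` set ws" and ws: "admissible ws"
  shows "\<phi> (a j * embed_prod a ws) = 0" "\<phi> (star (a j) * embed_prod a ws) = 0"
proof -
  show "\<phi> (a j * embed_prod a ws) = 0"
    using sym_odd_zero_aux[OF j ws, of "mat_unit 1 2"] norm_sum_annihilators_le
    by (simp add: embed_units)
  \<comment> \<open>The creators sum to the adjoint of the sum of the annihilators, so the same norm
    bound applies.\<close>
  have "(norm (\<Sum>i\<in>F. star (a i)))\<^sup>2 \<le> card F" if "finite F" "F \<subseteq> {1..}" for F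
    using norm_sum_annihilators_le[OF that] by (simp flip: star_sum)
  then show "\<phi> (star (a j) * embed_prod a ws) = 0"
    using sym_odd_zero_aux[OF j ws, of "mat_unit 2 1"] by (simp add: embed_units)
qed

lemma sym_embed_reduce:
  assumes j: "j \<ge> 1" "j \<notin> fst ` set ws" and ws: "admissible ws"
  shows "\<phi> (car_embed a j A * embed_prod a ws) =
    A $ 1 $ 1 * \<phi> (embed_prod a ws) + (A $ 2 $ 2 - A $ 1 $ 1) * \<phi> (star (a j) * a j * embed_prod a ws)"
  using sym_odd_zero[OF assms] j
  by (simp add: car_embed_def a_star_a distrib_right left_diff_distrib mult_scaleC_left blinfun.add_right
      blinfun.diff_right state_scaleC[OF sym_state] scaleC_diff_right algebra_simps)

lemma factors_apply:
  assumes "number_factorizes a p \<phi>" "admissible ws"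
  shows "\<phi> (embed_prod a ws) = prod_list (map (\<lambda>(j, A). diag_functional p A) ws)"
  using assms(2)
proof (induction ws)
  case Nil
  show ?case by (simp add: state_one[OF sym_state])
next
  case (Cons w ws)
  obtain j A where w: "w = (j, A)" by (cases w)
  with Cons.prems assms(1) have "\<phi> (embed_prod a (w # ws)) =
      A $ 1 $ 1 * \<phi> (embed_prod a ws) + (A $ 2 $ 2 - A $ 1 $ 1) * (p * \<phi> (embed_prod a ws))"
    by (simp add: sym_embed_reduce number_factorizes_def)
  then show ?case using Cons w by (simp add: diag_functional_def algebra_simps)
qed

text \<open>Positivity of the witness \<open>diag_functional p\<close> is inherited from
  \<open>\<phi>\<close>, of which it is the restriction to site 1 along the *-homomorphism
  \<open>car_embed a 1\<close>.\<close>

lemma factors_product_state: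
  assumes "number_factorizes a p \<phi>"
  shows "\<exists>\<rho>. mat2_state \<rho> \<and> mat2_even \<rho> \<and> is_product_state a \<rho> \<phi>"
proof (intro exI conjI)
  let ?\<rho> = "diag_functional p"
  have \<rho>: "\<phi> (car_embed a 1 A) = ?\<rho> A" for A
    using factors_apply[OF assms, of "[(1, A)]"] by simp
  have "?\<rho> (adjoint_mat A ** A) \<in> \<real>\<^sub>\<ge>\<^sub>0" for A
    using sym_state unfolding state_def
    by (metis \<rho> embed_mult embed_star le_refl)
  then show "mat2_state ?\<rho>"
    by (simp add: mat2_state_def) (simp add: diag_functional_def algebra_simps mat_def)
  show "mat2_even ?\<rho>"
    by (simp add: mat2_even_def mat2_grading_def diag_functional_def)
  have "\<phi> (prod_list (map2 (car_embed a) js As)) = prod_list (map ?\<rho> As)"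
    if "distinct js" "set js \<subseteq> {1..}" "length As = length js" for js As
  proof -
    have "admissible (zip js As)" using that by (simp add: admissible_def flip: set_map)
    then have "\<phi> (embed_prod a (zip js As)) = prod_list (map ?\<rho> (map snd (zip js As)))"
      unfolding factors_apply[OF assms \<open>admissible (zip js As)\<close>] by (simp only: case_prod_unfold map_map comp_def)
    then show ?thesis using that by (simp add: embed_prod_def)
  qed
  then show "is_product_state a ?\<rho> \<phi>" by (simp add: is_product_state_def sym_state)
qed

lemma sym_number: "j \<ge> 1 \<Longrightarrow> \<phi> (star (a j) * a j) = \<phi> (star (a 1) * a 1)"
  using sym_fresh[of j "[]" 1 "mat_unit 2 2"] by (simp add: embed_units)

lemma sym_number_fresh:
  assumes "i \<ge> 1" "i \<notin> fst ` set ws" "k \<ge> 1" "k \<notin> fst ` set ws" "admissible ws"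
  shows "\<phi> (star (a i) * a i * embed_prod a ws) = \<phi> (star (a k) * a k * embed_prod a ws)"
  using sym_fresh[OF assms, of "mat_unit 2 2"] by (simp add: embed_units)

text \<open>By symmetry the correlation of \<open>star (a j) * a j\<close> with a word avoiding
  \<open>j\<close> does not change when the swap moves \<open>j\<close> to a fresh site. The
  clustering sequence is thus eventually constant, and its limit is already the original
  value.\<close>

lemma strongly_clustering_factors:
  assumes "strongly_clustering a \<phi>"
  shows "number_factorizes a (\<phi> (star (a 1) * a 1)) \<phi>"
  unfolding number_factorizes_def
proof (intro allI impI, elim conjE)
  fix j and ws :: "(nat \<times> (complex^2^2)) list"
  assume j: "j \<ge> 1" "j \<notin> fst ` set ws" and ws: "admissible ws"
  define x where "x = star (a j) * a j"
  define y where "y = embed_prod a ws"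
  obtain M where M: "\<And>k. k > M \<Longrightarrow> k \<notin> fst ` set ws" using fresh_above by blast
  have "\<phi> (car_action a (block_swap (Suc n)) x * y) = \<phi> (x * y)" if n: "n \<ge> max j M" for n
  proof -
    define g where "g = block_swap (Suc n)"
    have g: "g \<in> fin_perms" by (simp add: g_def block_swap_fin_perms)
    have gj: "g j = 2 ^ n + j" using j n by (simp add: g_def block_swap_gt)
    have "2 ^ n + j > M" using n less_exp[of n] by linarith
    then have "\<phi> (star (a (2 ^ n + j)) * a (2 ^ n + j) * y) = \<phi> (x * y)"
      unfolding x_def y_def using j ws M by (intro sym_number_fresh) auto
    moreover have "car_action a g x = star (a (2 ^ n + j)) * a (2 ^ n + j)"
      using car_action[OF g] j gj by (simp add: x_def aut_mult aut_star)
    ultimately show ?thesis by (simp add: g_def)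
  qed
  then have "(\<lambda>n. \<phi> (car_action a (block_swap (Suc n)) x * y)) \<longlonglongrightarrow> \<phi> (x * y)"
    by (intro tendsto_eventually eventually_sequentiallyI)
  moreover have "(\<lambda>n. \<phi> (car_action a (block_swap (Suc n)) x * y)) \<longlonglongrightarrow> \<phi> x * \<phi> y"
    using assms LIMSEQ_Suc unfolding strongly_clustering_def by blast
  ultimately have "\<phi> (x * y) = \<phi> x * \<phi> y" by (rule LIMSEQ_unique)
  then show "\<phi> (star (a j) * a j * embed_prod a ws) = \<phi> (star (a 1) * a 1) * \<phi> (embed_prod a ws)"
    using sym_number[OF j(1)] by (simp add: x_def y_def)
qed

end

lemma factors_unique:
  assumes "\<phi> \<in> symmetric_states a" "\<psi> \<in> symmetric_states a" "number_factorizes a p \<phi>" "number_factorizes a p \<psi>"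
  shows "\<phi> = \<psi>"
  using assms by (intro blinfun_eq_if_eq_on_embed_prod) (simp_all add: sym_state factors_apply)

end

section \<open>Extreme points\<close>

context car
begin

text \<open>
  Law of large numbers: the deviation of the empirical number operator from \<open>p\<close> is small in mean
  square for \<open>\<phi>\<close>, hence for \<open>\<psi>\<close> as well.
\<close>

lemma dominated_factors:
  assumes \<phi>: "\<phi> \<in> symmetric_states a" "number_factorizes a p \<phi>"
    and \<psi>: "\<psi> \<in> symmetric_states a"
    and t: "t > 0" "\<And>x. t * Re (\<psi> (star x * x)) \<le> Re (\<phi> (star x * x))"
  shows "number_factorizes a p \<psi>"
  unfolding number_factorizes_def
proof (intro allI impI, elim conjE)
  fix j and ws :: "(nat \<times> (complex^2^2)) list"
  assume j: "j \<ge> 1" "j \<notin> fst ` set ws" and ws: "admissible ws"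
  note st\<phi> = sym_state[OF \<phi>(1)] and st\<psi> = sym_state[OF \<psi>]
  obtain M where M: "\<And>k. k > M \<Longrightarrow> k \<notin> fst ` set ws" using fresh_above by blast
  define n where "n i = star (a i) * a i" for i
  define y where "y = embed_prod a ws"
  define d where "d = \<psi> (n j * y) - p * \<psi> y"
  define K where "K = Re (\<psi> (star y * y))"
  have n: "\<phi> (n i) = p" if "i \<ge> 1" for i
    using \<phi>(2) that state_one[OF st\<phi>] unfolding number_factorizes_def
    by (metis admissible_simps(1) embed_prod_simps(1) empty_iff image_empty list.set(1) mult_1_right n_def)
  \<comment> \<open>Distinct sites are uncorrelated in \<open>\<phi>\<close>; at equal sites
    idempotence gives \<open>p\<close>.\<close>
  have nn: "\<phi> (n i * n k) = (if i = k then p else p * p)" if "i \<ge> 1" "k \<ge> 1" for i k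
  proof (cases "i = k")
    case True
    then show ?thesis using n that by (simp add: n_def number_idem)
  next
    case False
    have "\<phi> (n i * embed_prod a [(k, mat_unit 2 2)]) = p * \<phi> (embed_prod a [(k, mat_unit 2 2)])"
      unfolding n_def using that False by (intro \<phi>(2)[unfolded number_factorizes_def, rule_format]) auto
    then show ?thesis using False n that by (simp add: embed_units flip: n_def)
  qed
  define r where "r = Re p"
  have p: "p = of_real r"
    using state_nonneg(1)[OF st\<phi>, of "a 1"] n[of 1] by (simp add: n_def r_def)
  have "real N * (cmod d)\<^sup>2 \<le> K / t" for N
  proof (cases "N = 0")
    case False
    define F where "F = {M<..M + N}"
    have F: "finite F" "F \<subseteq> {1..}" "F \<inter> fst ` set ws = {}" "card F = N"
      using M by (force simp: F_def)+
    \<comment> \<open>\<open>Q\<close> is the total deviation of the number operators on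
      \<open>N\<close> sites outside the word from their mean under \<open>\<phi>\<close>; its
      variance grows only linearly in \<open>N\<close>.\<close>
    define Q where "Q = (\<Sum>i\<in>F. n i - p *\<^sub>C 1)"
    have "star Q = Q"
      by (simp add: Q_def star_sum star_diff star_scaleC n_def number_selfadjoint p)
    have "\<phi> (Q * Q) = (\<Sum>i\<in>F. \<Sum>k\<in>F. \<phi> ((n i - p *\<^sub>C 1) * (n k - p *\<^sub>C 1)))"
      by (simp add: Q_def sum_product blinfun.sum_right)
    also have "\<dots> = (\<Sum>i\<in>F. \<Sum>k\<in>F. if i = k then p - p * p else 0)"
    proof (intro sum.cong refl)
      fix i k assume "i \<in> F" "k \<in> F"
      then have "i \<ge> 1" "k \<ge> 1" using F(2) by auto
      then show "\<phi> ((n i - p *\<^sub>C 1) * (n k - p *\<^sub>C 1)) = (if i = k then p - p * p else 0)"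
        by (simp add: left_diff_distrib right_diff_distrib mult_scaleC_left mult_scaleC_right nn n
            blinfun.diff_right state_scaleC[OF st\<phi>] state_one[OF st\<phi>] scaleC_diff_right scaleC_scaleC)
    qed
    also have "\<dots> = of_nat N * (p - p * p)" using F(1,4) by simp
    also have "\<dots> = of_real (real N * (r - r * r))" by (simp add: p)
    finally have "Re (\<phi> (Q * Q)) = real N * (r - r * r)" by simp
    also have "\<dots> \<le> real N * 1"
    proof (rule mult_left_mono)
      show "r - r * r \<le> 1"
        using zero_le_square[of "r - 1 / 2"] by (simp add: algebra_simps)
    qed simp
    \<comment> \<open>Domination transfers the variance bound from \<open>\<phi>\<close> to
      \<open>\<psi>\<close> at the price of the factor \<open>1 / t\<close>.\<close>
    finally have Q: "Re (\<psi> (Q * Q)) \<le> real N / t"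
      using t(2)[of Q] t(1) by (simp add: \<open>star Q = Q\<close> field_simps)
    have "\<psi> ((\<Sum>i\<in>F. n i) * y) = of_nat N * \<psi> (n j * y)"
      using sym_average[OF \<psi> j F(1-3) ws, of "mat_unit 2 2"] F(4)
      by (simp add: embed_units y_def n_def)
    moreover have "\<psi> (Q * y) = \<psi> ((\<Sum>i\<in>F. n i) * y) - (\<Sum>i\<in>F. p * \<psi> y)"
      by (simp only: Q_def sum_subtractf left_diff_distrib sum_distrib_right mult_scaleC_left mult_1_left
          blinfun.diff_right blinfun.sum_right state_scaleC[OF st\<psi>])
    ultimately have "\<psi> (Q * y) = of_nat N * d"
      by (simp add: d_def F(4) right_diff_distrib)
    \<comment> \<open>Cauchy-Schwarz bounds a quantity quadratic in \<open>N\<close> by one linear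
      in \<open>N\<close>, which forces \<open>d = 0\<close>.\<close>
    then have "(real N * cmod d)\<^sup>2 \<le> Re (\<psi> (Q * Q)) * K"
      using state_Cauchy_Schwarz[OF st\<psi>, of Q y] by (simp add: \<open>star Q = Q\<close> norm_mult K_def)
    also have "\<dots> \<le> real N / t * K"
      using Q state_nonneg(2)[OF st\<psi>, of y] by (intro mult_right_mono) (auto simp: K_def)
    finally have "real N * (real N * (cmod d)\<^sup>2) \<le> real N * (K / t)"
      by (simp add: power2_eq_square ac_simps)
    then show ?thesis using False by (metis mult_le_cancel_left_pos of_nat_0_less_iff not_gr_zero)
  qed (use state_nonneg(2)[OF st\<psi>, of y] t(1) in \<open>simp add: K_def\<close>)
  then have "(cmod d)\<^sup>2 \<le> 0" by (rule nat_mult_bounded_imp_nonpos)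
  then show "\<psi> (star (a j) * a j * embed_prod a ws) = p * \<psi> (embed_prod a ws)"
    by (simp add: d_def n_def y_def)
qed

text \<open>A multiple of each component of a proper convex decomposition is dominated by
  \<open>\<phi>\<close>, so both components factorize with the same \<open>p\<close>; by
  \<open>factors_unique\<close> they coincide.\<close>

lemma factors_extreme:
  assumes \<phi>: "\<phi> \<in> symmetric_states a" "number_factorizes a p \<phi>"
  shows "\<phi> extreme_point_of symmetric_states a"
  unfolding extreme_point_of_def
proof (intro conjI ballI notI)
  fix \<psi>1 \<psi>2 assume \<psi>: "\<psi>1 \<in> symmetric_states a" "\<psi>2 \<in> symmetric_states a" and seg: "\<phi> \<in> open_segment \<psi>1 \<psi>2"
  from seg obtain u where ne: "\<psi>1 \<noteq> \<psi>2" and u: "0 < u" "u < 1" "\<phi> = (1 - u) *\<^sub>R \<psi>1 + u *\<^sub>R \<psi>2"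
    unfolding in_segment by blast
  have eq: "Re (\<phi> x) = (1 - u) * Re (\<psi>1 x) + u * Re (\<psi>2 x)" for x
    by (simp add: u(3) blinfun.add_left blinfun.scaleR_left)
  have nn: "0 \<le> Re (\<psi>1 (star x * x))" "0 \<le> Re (\<psi>2 (star x * x))" for x
    using \<psi> by (simp_all add: sym_state state_nonneg(2))
  have "number_factorizes a p \<psi>1"
    using u(1,2) nn by (intro dominated_factors[OF \<phi> \<psi>(1), of "1 - u"]) (simp_all add: eq)
  moreover have "number_factorizes a p \<psi>2"
    using u(1,2) nn by (intro dominated_factors[OF \<phi> \<psi>(2), of u]) (simp_all add: eq)
  ultimately show False using factors_unique \<psi> ne by blast
qed (rule \<phi>)

text \<open>For \<open>0 < p < 1\<close> the limit \<open>h\<close> of the functionals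
  \<open>f k\<close> exhibits \<open>\<phi>\<close> as a mixture of \<open>h / p\<close> and
  \<open>(\<phi> - h) / (1 - p)\<close>, and extremality forces \<open>h = p * \<phi>\<close>. On
  words \<open>h\<close> is computed by any fresh site, which is the factorization.\<close>

lemma extreme_factors:
  assumes ext: "\<phi> extreme_point_of symmetric_states a"
  shows "number_factorizes a (\<phi> (star (a 1) * a 1)) \<phi>"
proof -
  have sym: "\<phi> \<in> symmetric_states a" using ext by (simp add: extreme_point_of_def)
  note st = sym_state[OF sym]
  define n where "n i = star (a i) * a i" for i
  define p where "p = Re (\<phi> (n 1))"
  have n: "\<phi> (n i) = of_real p" if "i \<ge> 1" for i
    using sym_number[OF sym that] state_nonneg(1)[OF st, of "a 1"] by (simp add: n_def p_def)
  have star_n: "star (n i) = n i" for i by (simp add: n_def number_selfadjoint)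
  have n_idem: "n i * n i = n i" if "i \<ge> 1" for i using that by (simp add: n_def number_idem)
  have hole: "star (1 - n i) * (1 - n i) = 1 - n i" if "i \<ge> 1" for i
    using n_idem[OF that] by (simp add: star_diff star_n algebra_simps)
  have "0 \<le> p" using state_nonneg(2)[OF st, of "a 1"] by (simp add: p_def n_def)
  have "p \<le> 1"
    using state_nonneg(2)[OF st, of "1 - n 1"] hole[of 1] n[of 1]
    by (simp add: blinfun.diff_right state_one[OF st])
  have zero: "\<phi> (q * y) = 0" if "\<phi> (star q * q) = 0" "star q = q" for q y
    using state_Cauchy_Schwarz[OF st, of q y] that by simp
  have "\<phi> (n j * embed_prod a ws) = of_real p * \<phi> (embed_prod a ws)"
    if j: "j \<ge> 1" "j \<notin> fst ` set ws" and ws: "admissible ws" for j ws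
  proof -
    \<comment> \<open>At the endpoints one of the normalizations by \<open>p\<close> and
      \<open>1 - p\<close> degenerates; there the number operator or its complement has expectation
      zero and Cauchy-Schwarz suffices.\<close>
    consider "p = 0" | "p = 1" | "0 < p" "p < 1" using \<open>0 \<le> p\<close> \<open>p \<le> 1\<close> by linarith
    then show ?thesis
    proof cases
      case 1
      then show ?thesis using zero[of "n j"] n[OF j(1)] n_idem[OF j(1)] star_n by simp
    next
      case 2
      have "\<phi> ((1 - n j) * embed_prod a ws) = 0"
      proof (rule zero)
        show "\<phi> (star (1 - n j) * (1 - n j)) = 0"
          unfolding hole[OF j(1)] using 2 by (simp add: blinfun.diff_right state_one[OF st] n[OF j(1)])
      qed (simp add: star_diff star_n)
      then show ?thesis using 2 by (simp add: left_diff_distrib blinfun.diff_right)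
    next
      case 3
      \<comment> \<open>\<open>Suc k\<close> keeps the site index at least 1.\<close>
      define f where "f k x = \<phi> (n (Suc k) * x)" for k x
      have f_add: "f k (x + y) = f k x + f k y" and f_diff: "f k (x - y) = f k x - f k y"
        and f_scaleC: "f k (c *\<^sub>C x) = c * f k x" for k x y c
        by (simp_all add: f_def distrib_left right_diff_distrib mult_scaleC_right blinfun.add_right
            blinfun.diff_right state_scaleC[OF st])
      have n_norm: "norm (n (Suc k)) \<le> 1" for k using norm_number_le[of "Suc k"] by (simp add: n_def)
      have f_norm: "norm (f k x) \<le> norm \<phi> * norm x" for k x
      proof -
        have "norm (n (Suc k) * x) \<le> 1 * norm x"
          by (rule order_trans[OF norm_mult_ineq mult_right_mono[OF n_norm norm_ge_zero]])
        then show ?thesis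
          unfolding f_def by (metis mult_1 mult_left_mono norm_blinfun norm_ge_zero order_trans)
      qed
      have f_mono: "eventually (\<lambda>k. f k (embed_prod a vs) = \<phi> (n i * embed_prod a vs)) sequentially"
        if vs: "admissible vs" "i \<ge> 1" "i \<notin> fst ` set vs" for i vs
      proof -
        obtain M where M: "\<And>k. k > M \<Longrightarrow> k \<notin> fst ` set vs" using fresh_above by blast
        have "f k (embed_prod a vs) = \<phi> (n i * embed_prod a vs)" if "k \<ge> M" for k
          unfolding f_def n_def using M that vs by (intro sym_number_fresh[OF sym]) auto
        then show ?thesis by (rule eventually_sequentiallyI)
      qed
      \<comment> \<open>On words the sequence is eventually constant; the Cauchy property carries
        convergence over to all \<open>x\<close>.\<close>
      have "x \<in> {x. Cauchy (\<lambda>k. f k x)}" for x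
      proof (rule embed_prod_dense)
        show "closed {x. Cauchy (\<lambda>k. f k x)}"
          by (rule Cauchy_closed[OF f_diff f_norm])
        have "f k 0 = 0" for k by (simp add: f_def)
        then show "complex_subspace {x. Cauchy (\<lambda>k. f k x)}"
          by (auto simp: complex_subspace_def f_add f_scaleC Cauchy_convergent_iff
              intro: convergent_add convergent_mult convergent_const)
      next
        fix vs :: "(nat \<times> (complex^2^2)) list" assume vs: "admissible vs"
        obtain M where "\<And>k. k > M \<Longrightarrow> k \<notin> fst ` set vs" using fresh_above by blast
        then have "(\<lambda>k. f k (embed_prod a vs)) \<longlonglongrightarrow> \<phi> (n (Suc M) * embed_prod a vs)"
          using vs by (intro tendsto_eventually f_mono) auto
        then show "embed_prod a vs \<in> {x. Cauchy (\<lambda>k. f k x)}"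
          by (simp add: LIMSEQ_imp_Cauchy)
      qed
      then have conv: "convergent (\<lambda>k. f k x)" for x by (simp add: Cauchy_convergent)
      define h where "h x = lim (\<lambda>k. f k x)" for x
      have f_lim: "(\<lambda>k. f k x) \<longlonglongrightarrow> h x" for x
        using conv by (simp add: h_def convergent_LIMSEQ_iff)
      have h_scaleC: "h (c *\<^sub>C x) = c * h x" for c x
        using f_lim[of "c *\<^sub>C x"] tendsto_mult_left[OF f_lim[of x], of c]
        by (intro LIMSEQ_unique) (auto simp: f_scaleC)
      have "bounded_linear h"
      proof (rule bounded_linear_intro)
        show "h (x + y) = h x + h y" for x y
          using f_lim[of "x + y"] tendsto_add[OF f_lim[of x] f_lim[of y]]
          by (intro LIMSEQ_unique) (auto simp: f_add)
        show "h (r *\<^sub>R x) = r *\<^sub>R h x" for r x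
          by (simp add: scaleR_scaleC h_scaleC scaleR_conv_of_real)
        show "norm (h x) \<le> norm x * norm \<phi>" for x
          using tendsto_norm[OF f_lim[of x]] f_norm[of _ x]
          by (intro LIMSEQ_le_const2) (auto simp: mult.commute)
      qed
      define H where "H = Blinfun h"
      have H: "blinfun_apply H = h" unfolding H_def using \<open>bounded_linear h\<close> by (rule bounded_linear_Blinfun_apply)
      have h_one: "h 1 = p"
        using f_lim[of 1] by (intro LIMSEQ_unique) (auto simp: f_def n)
      \<comment> \<open>A permutation of finite support fixes the number operators far out, so
        invariance of \<open>\<phi>\<close> passes to the limit.\<close>
      have h_sym: "h (car_action a g x) = h x" if g: "g \<in> fin_perms" for g x
      proof -
        note aut = car_action(1)[OF g]
        have "finite {k. g k \<noteq> k}" using g by (simp add: fin_perms_def)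
        then obtain M where M: "\<And>k. k > M \<Longrightarrow> g k = k"
          by (metis (mono_tags, lifting) finite_nat_set_iff_bounded_le leD mem_Collect_eq)
        have "f k (car_action a g x) = f k x" if "k \<ge> M" for k
        proof -
          have "car_action a g (n (Suc k)) = n (Suc k)"
            using car_action(2)[OF g, of "Suc k"] M[of "Suc k"] that
            by (simp add: n_def aut_mult[OF aut] aut_star[OF aut])
          then show ?thesis
            using sym_action[OF sym g, of "n (Suc k) * x"] by (simp add: f_def aut_mult[OF aut])
        qed
        then have "(\<lambda>k. f k (car_action a g x)) \<longlonglongrightarrow> h x"
          by (intro Lim_transform_eventually[OF f_lim[of x]] eventually_sequentiallyI[of M]) simp
        then show ?thesis using f_lim LIMSEQ_unique by blast
      qed
      \<comment> \<open>Inside \<open>\<phi>\<close>, number operators far out asymptotically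
        commute with every element; this moves \<open>n (Suc k)\<close> between
        \<open>star x\<close> and \<open>x\<close>, where positivity becomes visible.\<close>
      have comm: "(\<lambda>k. \<phi> (x * n (Suc k) * z) - f k (x * z)) \<longlonglongrightarrow> 0" for x z
      proof -
        define T where "T k x = \<phi> (x * n (Suc k) * z) - f k (x * z)" for k x
        have T: "T k (x + y) = T k x + T k y" "T k (x - y) = T k x - T k y" "T k (c *\<^sub>C x) = c * T k x" for k x y c
          by (simp_all add: T_def f_def algebra_simps mult_scaleC_left mult_scaleC_right blinfun.add_right
            blinfun.diff_right state_scaleC[OF st])
        have T_norm: "norm (T k x) \<le> 2 * norm \<phi> * norm z * norm x" for k x
        proof -
          have "norm (x * n (Suc k)) \<le> norm x * 1"
            by (rule order_trans[OF norm_mult_ineq mult_left_mono[OF n_norm norm_ge_zero]])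
          then have "norm (x * n (Suc k) * z) \<le> norm x * norm z"
            by (metis mult.right_neutral mult_right_mono norm_ge_zero norm_mult_ineq order_trans)
          then have "norm (\<phi> (x * n (Suc k) * z)) \<le> norm \<phi> * (norm x * norm z)"
            by (meson mult_left_mono norm_blinfun norm_ge_zero order_trans)
          moreover have "norm (f k (x * z)) \<le> norm \<phi> * (norm x * norm z)"
            by (meson f_norm mult_left_mono norm_ge_zero norm_mult_ineq order_trans)
          ultimately show ?thesis
            unfolding T_def using norm_triangle_ineq4[of "\<phi> (x * n (Suc k) * z)" "f k (x * z)"]
            by (simp add: ac_simps)
        qed
        have "x \<in> {x. (\<lambda>k. T k x) \<longlonglongrightarrow> 0}"
        proof (rule embed_prod_dense)
          show "closed {x. (\<lambda>k. T k x) \<longlonglongrightarrow> 0}" by (rule tendsto_zero_closed[OF T(2) T_norm])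
          show "complex_subspace {x. (\<lambda>k. T k x) \<longlonglongrightarrow> 0}" by (rule tendsto_zero_complex_subspace[OF T(1,3)])
        next
          fix vs :: "(nat \<times> (complex^2^2)) list" assume vs: "admissible vs"
          obtain M where M: "\<And>k. k > M \<Longrightarrow> k \<notin> fst ` set vs" using fresh_above by blast
          have "T k (embed_prod a vs) = 0" if "k \<ge> M" for k
            using number_commute_embed_prod[of "Suc k" vs] vs M[of "Suc k"] that
            by (simp add: T_def f_def n_def mult.assoc)
          then have "(\<lambda>k. T k (embed_prod a vs)) \<longlonglongrightarrow> 0"
            by (intro tendsto_eventually eventually_sequentiallyI)
          then show "embed_prod a vs \<in> {x. (\<lambda>k. T k x) \<longlonglongrightarrow> 0}" by simp
        qed
        then show ?thesis by (simp add: T_def)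
      qed
      have h_lim: "(\<lambda>k. \<phi> (star x * n (Suc k) * x)) \<longlonglongrightarrow> h (star x * x)" for x
        using tendsto_add[OF comm[of "star x" x] f_lim[of "star x * x"]] by simp
      \<comment> \<open>Idempotence makes the approximants values of \<open>\<phi>\<close> at
        \<open>star z * z\<close> with \<open>z = n (Suc k) * x\<close>; \<open>h_le\<close> uses
        the complementary projection in the same way.\<close>
      have h_pos: "h (star x * x) \<in> \<real>\<^sub>\<ge>\<^sub>0" for x
      proof (rule Lim_in_closed_set[OF closed_nonneg_Reals_complex _ _ h_lim])
        have "\<phi> (star (n (Suc k) * x) * (n (Suc k) * x)) = \<phi> (star x * n (Suc k) * x)" for k
          using n_idem[of "Suc k"] by (simp add: star_mult star_n mult.assoc) (simp flip: mult.assoc)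
        then have "\<phi> (star x * n (Suc k) * x) \<in> \<real>\<^sub>\<ge>\<^sub>0" for k
          using st unfolding state_def by metis
        then show "\<forall>\<^sub>F k in sequentially. \<phi> (star x * n (Suc k) * x) \<in> \<real>\<^sub>\<ge>\<^sub>0" by simp
      qed simp
      have h_le: "\<phi> (star x * x) - h (star x * x) \<in> \<real>\<^sub>\<ge>\<^sub>0" for x
      proof (rule Lim_in_closed_set[OF closed_nonneg_Reals_complex _ _ tendsto_diff[OF tendsto_const h_lim]])
        have "\<phi> (star ((1 - n (Suc k)) * x) * ((1 - n (Suc k)) * x)) =
            \<phi> (star x * x) - \<phi> (star x * n (Suc k) * x)" for k
        proof -
          have "star ((1 - n (Suc k)) * x) * ((1 - n (Suc k)) * x) =
              star x * (star (1 - n (Suc k)) * (1 - n (Suc k))) * x"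
            by (simp add: star_mult mult.assoc)
          also have "\<dots> = star x * (1 - n (Suc k)) * x" using hole[of "Suc k"] by simp
          also have "\<dots> = star x * x - star x * n (Suc k) * x"
            by (simp add: left_diff_distrib right_diff_distrib)
          finally show ?thesis by (simp only: blinfun.diff_right)
        qed
        then have "\<phi> (star x * x) - \<phi> (star x * n (Suc k) * x) \<in> \<real>\<^sub>\<ge>\<^sub>0" for k
          using st unfolding state_def by metis
        then show "\<forall>\<^sub>F k in sequentially. \<phi> (star x * x) - \<phi> (star x * n (Suc k) * x) \<in> \<real>\<^sub>\<ge>\<^sub>0" by simp
      qed simp
      define \<psi>1 where "\<psi>1 = (1 / p) *\<^sub>R H"
      define \<psi>2 where "\<psi>2 = (1 / (1 - p)) *\<^sub>R (\<phi> - H)"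
      have nonneg: "r *\<^sub>R z \<in> \<real>\<^sub>\<ge>\<^sub>0" if "z \<in> \<real>\<^sub>\<ge>\<^sub>0" "r \<ge> 0" for r and z :: complex
        using that by (simp add: complex_nonneg_Reals_iff)
      have "\<psi>1 \<in> symmetric_states a"
        using 3 h_sym h_one h_pos nonneg
        by (simp add: symmetric_states_def state_def \<psi>1_def blinfun.scaleR_left H h_scaleC)
          (simp add: scaleR_conv_of_real)
      moreover have "\<psi>2 \<in> symmetric_states a"
        using 3 h_sym h_one h_le nonneg sym_action[OF sym]
        by (simp add: symmetric_states_def state_def \<psi>2_def blinfun.scaleR_left blinfun.diff_left H h_scaleC
            state_scaleC[OF st] state_one[OF st] right_diff_distrib)
          (simp add: scaleR_conv_of_real field_simps)
      moreover have \<phi>_eq: "\<phi> = (1 - p) *\<^sub>R \<psi>2 + p *\<^sub>R \<psi>1"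
        using 3 by (simp add: \<psi>1_def \<psi>2_def)
      \<comment> \<open>Otherwise \<open>\<phi>\<close> would lie in the open segment from
        \<open>\<psi>2\<close> to \<open>\<psi>1\<close>, at parameter \<open>p\<close>.\<close>
      ultimately have "\<psi>2 = \<psi>1"
        using ext 3 unfolding extreme_point_of_def in_segment by metis
      then have "\<phi> = \<psi>1" using \<phi>_eq by (simp flip: scaleR_left_distrib)
      then have "H = p *\<^sub>R \<phi>" using 3 by (simp add: \<psi>1_def)
      then have "h (embed_prod a ws) = of_real p * \<phi> (embed_prod a ws)"
        by (simp add: blinfun.scaleR_left scaleR_conv_of_real flip: H)
      moreover have "(\<lambda>k. f k (embed_prod a ws)) \<longlonglongrightarrow> \<phi> (n j * embed_prod a ws)"
        using f_mono[OF ws j] by (rule tendsto_eventually)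
      ultimately show ?thesis using f_lim LIMSEQ_unique by metis
    qed
  qed
  then show ?thesis using n[of 1] by (simp add: number_factorizes_def n_def)
qed

end

theorem theorem5p3:
  fixes a :: "nat \<Rightarrow> 'a::cstar_algebra"
    and \<phi> :: "'a \<Rightarrow>\<^sub>L complex"
  assumes "car_algebra a"
    and "\<phi> \<in> symmetric_states a"
  shows "(\<phi> extreme_point_of symmetric_states a \<longleftrightarrow> strongly_clustering a \<phi>) \<and>
    (strongly_clustering a \<phi> \<longleftrightarrow>
      (\<exists>\<rho>. mat2_state \<rho> \<and> mat2_even \<rho> \<and> is_product_state a \<rho> \<phi>))"
proof -
  interpret car a using assms(1) by (rule car.intro)
  note sym = assms(2)
  \<comment> \<open>The cycle runs from extreme through \<open>number_factorizes\<close> to product,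
    from product to clustering, and from clustering through \<open>number_factorizes\<close> back to
    extreme.\<close>
  show ?thesis
    using extreme_factors factors_product_state[OF sym] product_state_strongly_clustering
      strongly_clustering_factors[OF sym] factors_extreme[OF sym] by blast
qed

end
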